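(* There exists a computable enumeration without repetitions $(\psi_x)_{x\in\omega}$ of all unary partial computable functions such that the partial applicative structure $(\omega,\cdot)$ with $n\cdot m\simeq\psi_n(m)$ is extensional and contains an element $k$ which is total and satisfies $kab=a$ for all $a,b\in\omega$.
   Context: A partial applicative structure (pas) is a set with a partial binary application $ab$, left associative. An element $f$ is total if $fa$ is defined for all $a$. A pas $\mathcal{A}$ is extensional if for all $f,g\in\mathcal{A}$, $(\forall a\,(fa\simeq ga))\Rightarrow f=g$, where $\simeq$ means both sides undefined or both defined and equal. A computable enumeration is one for which $(x,y)\mapsto\psi_x(y)$ is partial computable; without repetitions means every unary partial computable function occurs exactly once. *)

theory Defs
  imports Main
begin

datatype recf =
    Z
  | S
  | Id nat
  | Cn recf "recf list"
  | Pr recf recf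
  | Mn recf

inductive eval :: "recf \<Rightarrow> nat list \<Rightarrow> nat \<Rightarrow> bool" where
  eval_Z: "eval Z xs 0"
| eval_S: "eval S [x] (Suc x)"
| eval_Id: "i < length xs \<Longrightarrow> eval (Id i) xs (xs ! i)"
| eval_Cn: "list_all2 (\<lambda>g y. eval g xs y) gs ys \<Longrightarrow> eval f ys z \<Longrightarrow> eval (Cn f gs) xs z"
| eval_Pr0: "eval f xs y \<Longrightarrow> eval (Pr f g) (0 # xs) y"
| eval_PrS: "eval (Pr f g) (x # xs) y \<Longrightarrow> eval g (x # y # xs) z \<Longrightarrow> eval (Pr f g) (Suc x # xs) z"
| eval_Mn: "eval f (x # xs) 0 \<Longrightarrow> (\<forall>y<x. \<exists>z. z \<noteq> 0 \<and> eval f (y # xs) z)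
             \<Longrightarrow> eval (Mn f) xs x"

definition partial_computable1 :: "(nat \<Rightarrow> nat option) \<Rightarrow> bool" where
  "partial_computable1 f \<longleftrightarrow> (\<exists>t. \<forall>x y. f x = Some y \<longleftrightarrow> eval t [x] y)"

definition partial_computable2 :: "(nat \<Rightarrow> nat \<Rightarrow> nat option) \<Rightarrow> bool" where
  "partial_computable2 f \<longleftrightarrow> (\<exists>t. \<forall>x m y. f x m = Some y \<longleftrightarrow> eval t [x, m] y)"

definition computable_enum_norep :: "(nat \<Rightarrow> nat \<Rightarrow> nat option) \<Rightarrow> bool" where
  "computable_enum_norep psi \<longleftrightarrow>
     partial_computable2 psi \<and>
     (\<forall>x. partial_computable1 (psi x)) \<and>
     (\<forall>f. partial_computable1 f \<longrightarrow> (\<exists>!x. psi x = f))"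

definition pas_total :: "('a \<Rightarrow> 'a \<Rightarrow> 'a option) \<Rightarrow> 'a \<Rightarrow> bool" where
  "pas_total app f \<longleftrightarrow> (\<forall>a. app f a \<noteq> None)"

text \<open>Option equality is exactly Kleene equality.\<close>
definition pas_extensional :: "('a \<Rightarrow> 'a \<Rightarrow> 'a option) \<Rightarrow> bool" where
  "pas_extensional app \<longleftrightarrow> (\<forall>f g. (\<forall>a. app f a = app g a) \<longrightarrow> f = g)"

definition app2 :: "('a \<Rightarrow> 'a \<Rightarrow> 'a option) \<Rightarrow> 'a \<Rightarrow> 'a \<Rightarrow> 'a \<Rightarrow> 'a option" where
  "app2 app k a b = Option.bind (app k a) (\<lambda>c. app c b)"

end

theory Submission
  imports Defs "HOL-Library.Nat_Bijection"
begin

text \<open>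
  The constant functions get indices of their own, computable from the value, and Kummer's
  priority-free version of Friedberg's construction enumerates all other partial computable
  functions without repetition. A computable list of the infinite graphs and the finite graphs of
  even cardinality is followed by guessing which of its entries are neither constant nor equal to an
  earlier one. A guess found wrong leaves behind a finite graph, which is completed to odd
  cardinality by a point that encodes its history. The finite graphs of odd cardinality that do not
  arise in this way form a decidable set and are added directly. The map from \<open>a\<close> to the index of the
  constant function \<open>a\<close> is then computable, and \<open>k\<close> is its index.
\<close>

section \<open>Computable functions on codes\<close>

text \<open>Nothing guarantees that an enumeration without repetitions admits a computable map from
  \<open>a\<close> to the index of the constant function \<open>a\<close>; therefore this map is
  built into the indices. Extensionality, by contrast, is nothing but the absence of repetitions.
  The obstacle is that neither equality of two graphs nor constancy can be decided at a finite
  stage, while a point once enumerated cannot be withdrawn. Restricting to arguments below a bound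
  turns both questions into finite tests. Abandoned guesses must collide neither with surviving ones
  nor with each other. Parity settles the first point: surviving graphs are infinite or of even
  size, and constant graphs are infinite as well. The added point settles the second. It also makes
  it decidable whether a given finite graph is an abandoned guess, which is what allows the missing
  graphs of odd size to be supplied exactly once.\<close>

inductive_cases eval_ZE: "eval Z xs y"
inductive_cases eval_SE: "eval S xs y"
inductive_cases eval_IdE: "eval (Id i) xs y"
inductive_cases eval_CnE: "eval (Cn f gs) xs y"
inductive_cases eval_PrE: "eval (Pr f g) xs y"
inductive_cases eval_MnE: "eval (Mn f) xs y"

lemma eval_deterministic: "eval t xs y \<Longrightarrow> eval t xs z \<Longrightarrow> y = z"
proof (induction arbitrary: z rule: eval.induct)
  case (eval_Cn xs gs ys f y)
  from eval_Cn.prems obtain zs where zs: "list_all2 (\<lambda>g. eval g xs) gs zs" "eval f zs z"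
    by (rule eval_CnE)
  have "ys = zs"
  proof (rule nth_equalityI)
    show len: "length ys = length zs"
      using list_all2_lengthD[OF eval_Cn.IH(1)] list_all2_lengthD[OF zs(1)] by simp
    fix i assume i: "i < length ys"
    show "ys ! i = zs ! i"
      using list_all2_nthD2[OF eval_Cn.IH(1) i] list_all2_nthD2[OF zs(1), of i] i len by auto
  qed
  then show ?case using zs(2) eval_Cn.IH(2) by simp
next
  case (eval_Pr0 f xs y g)
  from eval_Pr0.prems show ?case
    by (rule eval_PrE) (use eval_Pr0.IH in auto)
next
  case (eval_PrS f g x xs y y')
  from eval_PrS.prems show ?case
    by (rule eval_PrE) (use eval_PrS.IH in auto)
next
  case (eval_Mn f x xs)
  from eval_Mn.prems have z: "eval f (z # xs) 0" "\<forall>y<z. \<exists>v. v \<noteq> 0 \<and> eval f (y # xs) v"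
    by (auto elim: eval_MnE)
  \<comment> \<open>The smaller of two different results would have both a zero and a nonzero value
    under \<open>f\<close>.\<close>
  show ?case
  proof (rule linorder_cases[of x z])
    assume "x < z" then show ?thesis using z(2) eval_Mn.IH(1) by blast
  next
    assume "z < x" then show ?thesis using z(1) eval_Mn.IH(2) by blast
  qed
qed (auto elim: eval_ZE eval_SE eval_IdE)

text \<open>Bootstrapping device: with argument lists of fixed length, composition reduces to
  projections. Once pairing and its inverses are available, several arguments are packed into one
  code and closure rules are stated for unary functions.\<close>

definition list_computable :: "nat \<Rightarrow> (nat list \<Rightarrow> nat) \<Rightarrow> bool" where
  "list_computable k F \<longleftrightarrow> (\<exists>t. \<forall>xs. length xs = k \<longrightarrow> eval t xs (F xs))"

definition computable :: "(nat \<Rightarrow> nat) \<Rightarrow> bool" where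
  "computable f \<longleftrightarrow> (\<exists>t. \<forall>x. eval t [x] (f x))"

definition computable2 :: "(nat \<Rightarrow> nat \<Rightarrow> nat) \<Rightarrow> bool" where
  "computable2 f \<longleftrightarrow> (\<exists>t. \<forall>x y. eval t [x, y] (f x y))"

named_theorems list_computable_intros
named_theorems computable_intros

lemma list_computable_nth: "i < k \<Longrightarrow> list_computable k (\<lambda>xs. xs ! i)"
  unfolding list_computable_def by (metis eval_Id)

lemma list_computable_comp1:
  assumes "computable f" "list_computable k G"
  shows "list_computable k (\<lambda>xs. f (G xs))"
proof -
  obtain t where t: "\<And>x. eval t [x] (f x)" using assms(1) by (auto simp: computable_def)
  obtain u where u: "\<And>xs. length xs = k \<Longrightarrow> eval u xs (G xs)"
    using assms(2) by (auto simp: list_computable_def)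
  have "eval (Cn t [u]) xs (f (G xs))" if "length xs = k" for xs
    by (rule eval_Cn[of _ _ "[G xs]"]) (use t u that in auto)
  then show ?thesis unfolding list_computable_def by blast
qed

lemma list_computable_comp2:
  assumes "computable2 f" "list_computable k G" "list_computable k H"
  shows "list_computable k (\<lambda>xs. f (G xs) (H xs))"
proof -
  obtain t where t: "\<And>x y. eval t [x, y] (f x y)" using assms(1) by (auto simp: computable2_def)
  obtain u where u: "\<And>xs. length xs = k \<Longrightarrow> eval u xs (G xs)"
    using assms(2) by (auto simp: list_computable_def)
  obtain v where v: "\<And>xs. length xs = k \<Longrightarrow> eval v xs (H xs)"
    using assms(3) by (auto simp: list_computable_def)
  have "eval (Cn t [u, v]) xs (f (G xs) (H xs))" if "length xs = k" for xs
    by (rule eval_Cn[of _ _ "[G xs, H xs]"]) (use t u v that in auto)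
  then show ?thesis unfolding list_computable_def by blast
qed

lemma computable_Suc: "computable Suc"
  unfolding computable_def by (metis eval_S)

lemma list_computable_const: "list_computable k (\<lambda>_. c)"
proof (induction c)
  case 0
  show ?case unfolding list_computable_def by (metis eval_Z)
next
  case (Suc c)
  then show ?case using list_computable_comp1[OF computable_Suc] by fastforce
qed

lemma computable_if_list: "list_computable (Suc 0) (\<lambda>xs. f (xs ! 0)) \<Longrightarrow> computable f"
proof -
  assume "list_computable (Suc 0) (\<lambda>xs. f (xs ! 0))"
  then obtain t where t: "\<And>xs. length xs = Suc 0 \<Longrightarrow> eval t xs (f (xs ! 0))"
    unfolding list_computable_def by blast
  have "eval t [x] (f x)" for x using t[of "[x]"] by simp
  then show ?thesis unfolding computable_def by blast
qed

lemma computable2_if_list: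
  "list_computable (Suc (Suc 0)) (\<lambda>xs. f (xs ! 0) (xs ! Suc 0)) \<Longrightarrow> computable2 f"
proof -
  assume "list_computable (Suc (Suc 0)) (\<lambda>xs. f (xs ! 0) (xs ! Suc 0))"
  then obtain t where
    t: "\<And>xs. length xs = Suc (Suc 0) \<Longrightarrow> eval t xs (f (xs ! 0) (xs ! Suc 0))"
    unfolding list_computable_def by blast
  have "eval t [x, y] (f x y)" for x y using t[of "[x, y]"] by simp
  then show ?thesis unfolding computable2_def by blast
qed

lemma computable2_rec:
  assumes "computable a"
    and "list_computable (Suc (Suc (Suc 0))) (\<lambda>xs. h (xs ! 0) (xs ! Suc 0) (xs ! Suc (Suc 0)))"
    and "\<And>p. f 0 p = a p" and "\<And>n p. f (Suc n) p = h n (f n p) p"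
  shows "computable2 f"
proof -
  obtain t where t: "\<And>p. eval t [p] (a p)" using assms(1) by (auto simp: computable_def)
  obtain u where u: "\<And>xs. length xs = Suc (Suc (Suc 0)) \<Longrightarrow>
      eval u xs (h (xs ! 0) (xs ! Suc 0) (xs ! Suc (Suc 0)))"
    using assms(2) unfolding list_computable_def by blast
  have "eval (Pr t u) [n, p] (f n p)" for n p
  proof (induction n)
    case 0
    show ?case using t assms(3) by (simp add: eval_Pr0)
  next
    case (Suc n)
    show ?case using eval_PrS[OF Suc] u[of "[n, f n p, p]"] assms(4) by simp
  qed
  then show ?thesis unfolding computable2_def by blast
qed

lemma computable_rec:
  assumes "list_computable (Suc (Suc (Suc 0))) (\<lambda>xs. h (xs ! 0) (xs ! Suc 0))"
    and "\<And>n. f (Suc n) = h n (f n)"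
  shows "computable f"
proof -
  have "computable (\<lambda>_. f 0)" by (rule computable_if_list) (rule list_computable_const)
  then have "computable2 (\<lambda>n p. f n)"
    by (rule computable2_rec[where h = "\<lambda>n r p. h n r"]) (use assms in auto)
  then have "list_computable (Suc 0) (\<lambda>xs. (\<lambda>n p. f n) (xs ! 0) (xs ! 0))"
    by (rule list_computable_comp2) (auto intro: list_computable_nth)
  then show ?thesis by (intro computable_if_list) simp
qed

lemmas [list_computable_intros] =
  list_computable_nth list_computable_const list_computable_comp1[OF computable_Suc]

lemma computable_comp: "computable f \<Longrightarrow> computable g \<Longrightarrow> computable (\<lambda>z. f (g z))"
  by (rule computable_if_list, rule list_computable_comp1, assumption,
      rule list_computable_comp1, assumption, rule list_computable_nth, simp)

lemma computable_comp2:
  "computable2 f \<Longrightarrow> computable g \<Longrightarrow> computable h \<Longrightarrow> computable (\<lambda>z. f (g z) (h z))"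
  by (rule computable_if_list, rule list_computable_comp2, assumption;
      rule list_computable_comp1, assumption, rule list_computable_nth, simp)

lemma computable2_add: "computable2 (+)"
  by (rule computable2_rec[where a = "\<lambda>p. p" and h = "\<lambda>n r p. Suc r"])
    (auto intro!: list_computable_intros computable_if_list)

lemmas [list_computable_intros] = list_computable_comp2[OF computable2_add]

lemma computable2_mult: "computable2 (*)"
  by (rule computable2_rec[where a = "\<lambda>p. 0" and h = "\<lambda>n r p. p + r"])
    (auto intro!: list_computable_intros computable_if_list)

lemmas [list_computable_intros] = list_computable_comp2[OF computable2_mult]

lemma computable_pred: "computable (\<lambda>n. n - Suc 0)"
  by (rule computable_rec[where h = "\<lambda>n r. n"]) (auto intro!: list_computable_intros)

lemmas [list_computable_intros] = list_computable_comp1[OF computable_pred]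

lemma computable2_diff: "computable2 (-)"
proof -
  \<comment> \<open>Recursion has to run over the subtrahend; the arguments are swapped back
    afterwards.\<close>
  have "computable2 (\<lambda>n p. p - n)"
    by (rule computable2_rec[where a = "\<lambda>p. p" and h = "\<lambda>n r p. r - Suc 0"])
      (auto intro!: list_computable_intros computable_if_list)
  then have "list_computable (Suc (Suc 0)) (\<lambda>xs. (\<lambda>n p. p - n) (xs ! Suc 0) (xs ! 0))"
    by (rule list_computable_comp2) (auto intro: list_computable_nth)
  then show ?thesis by (intro computable2_if_list) simp
qed

lemmas [list_computable_intros] = list_computable_comp2[OF computable2_diff]

lemma computable_triangle: "computable triangle"
  by (rule computable_rec[where h = "\<lambda>n r. r + Suc n"])
    (auto intro!: list_computable_intros)

lemmas [list_computable_intros] = list_computable_comp1[OF computable_triangle]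

section \<open>Pairing and its inverses\<close>

abbreviation pair :: "nat \<Rightarrow> nat \<Rightarrow> nat" where
  "pair x y \<equiv> prod_encode (x, y)"

definition pfst :: "nat \<Rightarrow> nat" where "pfst n = fst (prod_decode n)"

definition psnd :: "nat \<Rightarrow> nat" where "psnd n = snd (prod_decode n)"

lemma pfst_pair [simp]: "pfst (pair x y) = x"
  by (simp add: pfst_def)

lemma psnd_pair [simp]: "psnd (pair x y) = y"
  by (simp add: psnd_def)

lemma pair_pfst_psnd [simp]: "pair (pfst n) (psnd n) = n"
  by (simp add: pfst_def psnd_def)

lemma pfst_le: "pfst n \<le> n"
  using le_prod_encode_1[of "pfst n" "psnd n"] by simp

lemma psnd_le: "psnd n \<le> n"
  using le_prod_encode_2[of "psnd n" "pfst n"] by simp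

lemma computable2_pair: "computable2 pair"
  by (rule computable2_if_list)
    (auto simp: prod_encode_def intro!: list_computable_intros)

lemmas [list_computable_intros] = list_computable_comp2[OF computable2_pair]

text \<open>The anti-diagonal on which a code lies, computed by comparing triangular numbers.\<close>

fun diagonal :: "nat \<Rightarrow> nat" where
  "diagonal 0 = 0"
| "diagonal (Suc n) = diagonal n + (1 - (triangle (Suc (diagonal n)) - Suc n))"

lemma diagonal_bounds: "triangle (diagonal n) \<le> n \<and> n < triangle (Suc (diagonal n))"
proof (induction n)
  case (Suc n)
  then show ?case
    by (cases "triangle (Suc (diagonal n)) \<le> Suc n") (auto simp: Suc_diff_le)
qed simp

lemma triangle_mono: "m \<le> n \<Longrightarrow> triangle m \<le> triangle n"
  unfolding triangle_def by (intro div_le_mono mult_le_mono) auto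

lemma diagonal_pair: "diagonal (pair x y) = x + y"
proof (rule antisym; rule ccontr)
  assume "\<not> diagonal (pair x y) \<le> x + y"
  then have "triangle (Suc (x + y)) \<le> triangle (diagonal (pair x y))"
    by (intro triangle_mono) simp
  with diagonal_bounds[of "pair x y"] show False by (simp add: prod_encode_def)
next
  assume "\<not> x + y \<le> diagonal (pair x y)"
  then have "triangle (Suc (diagonal (pair x y))) \<le> triangle (x + y)"
    by (intro triangle_mono) simp
  with diagonal_bounds[of "pair x y"] show False by (simp add: prod_encode_def)
qed

lemma computable_diagonal: "computable diagonal"
  by (rule computable_rec[where h = "\<lambda>n r. r + (Suc 0 - (triangle (Suc r) - Suc n))"])
    (auto simp del: triangle_Suc intro!: list_computable_intros)

lemmas [list_computable_intros] = list_computable_comp1[OF computable_diagonal]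

text \<open>\<open>pair x y\<close> is \<open>triangle (x + y) + x\<close>, and
  \<open>diagonal\<close> recovers \<open>x + y\<close>.\<close>

lemma pfst_eq: "pfst n = n - triangle (diagonal n)"
  using diagonal_pair[of "pfst n" "psnd n"] prod_decode_inverse[of n]
  by (simp add: pfst_def psnd_def prod_encode_def split: prod.splits)

lemma psnd_eq: "psnd n = diagonal n - pfst n"
  using diagonal_pair[of "pfst n" "psnd n"] by simp

lemma computable_pfst: "computable pfst"
  unfolding pfst_eq[abs_def]
  by (rule computable_if_list)
    (auto intro!: list_computable_intros)

lemmas [list_computable_intros] = list_computable_comp1[OF computable_pfst]

lemma computable_psnd: "computable psnd"
  unfolding psnd_eq[abs_def]
  by (rule computable_if_list)
    (auto intro!: list_computable_intros)

lemma computable_id [computable_intros]: "computable (\<lambda>z. z)"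
  by (rule computable_if_list) (auto intro: list_computable_intros)

lemma computable_const [computable_intros]: "computable (\<lambda>_. c)"
  by (rule computable_if_list) (auto intro: list_computable_intros)

lemmas [computable_intros] =
  computable_Suc[THEN computable_comp]
  computable_pfst[THEN computable_comp]
  computable_psnd[THEN computable_comp]
  computable2_add[THEN computable_comp2]
  computable2_diff[THEN computable_comp2]
  computable2_mult[THEN computable_comp2]
  computable2_pair[THEN computable_comp2]

text \<open>The workhorse for later closure rules, which rewrite an operation into a
  \<open>rec_nat\<close>. The step function reads counter, previous value and parameter from a
  single code, so its premise is again about a unary function and the rules can be applied
  recursively.\<close>

lemma computable_rec_nat [computable_intros]:
  assumes "computable n" "computable a"
    and "computable (\<lambda>w. h (pfst w) (pfst (psnd w)) (psnd (psnd w)))"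
  shows "computable (\<lambda>z. rec_nat (a z) (\<lambda>k r. h k r z) (n z))"
proof -
  have "computable2 (\<lambda>n z. rec_nat (a z) (\<lambda>k r. h k r z) n)"
  proof (rule computable2_rec[OF assms(2), where h = h])
    have "list_computable (Suc (Suc (Suc 0)))
        (\<lambda>xs. (\<lambda>w. h (pfst w) (pfst (psnd w)) (psnd (psnd w)))
          (pair (xs ! 0) (pair (xs ! Suc 0) (xs ! Suc (Suc 0)))))"
      by (rule list_computable_comp1[OF assms(3)])
        (auto intro!: list_computable_intros)
    then show "list_computable (Suc (Suc (Suc 0))) (\<lambda>xs. h (xs ! 0) (xs ! Suc 0) (xs ! Suc (Suc 0)))"
      by simp
  qed auto
  from computable_comp2[OF this assms(1) computable_id] show ?thesis .
qed

lemma computable_sum [computable_intros]: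
  assumes "computable n" "computable (\<lambda>w. f (pfst w) (psnd w))"
  shows "computable (\<lambda>z. \<Sum>k<n z. f k z)"
proof -
  have eq: "(\<Sum>k<m. f k z) = rec_nat 0 (\<lambda>k r. r + f k z) m" for m z
    by (induction m) auto
  have "computable (\<lambda>w. f (pfst w) (psnd (psnd w)))"
    using computable_comp[OF assms(2), of "\<lambda>w. pair (pfst w) (psnd (psnd w))"]
    by (simp add: computable_intros)
  then show ?thesis unfolding eq by (intro computable_intros assms)
qed

lemma computable2I:
  assumes "computable (\<lambda>p. f (pfst p) (psnd p))"
  shows "computable2 f"
proof (rule computable2_if_list)
  have "list_computable (Suc (Suc 0))
      (\<lambda>xs. (\<lambda>p. f (pfst p) (psnd p)) (pair (xs ! 0) (xs ! Suc 0)))"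
    by (rule list_computable_comp1[OF assms]) (auto intro!: list_computable_intros)
  then show "list_computable (Suc (Suc 0)) (\<lambda>xs. f (xs ! 0) (xs ! Suc 0))" by simp
qed

section \<open>Decidable predicates and bounded search\<close>

definition decidable :: "(nat \<Rightarrow> bool) \<Rightarrow> bool" where
  "decidable P \<longleftrightarrow> computable (\<lambda>z. of_bool (P z))"

lemma computable_of_bool [computable_intros]: "decidable P \<Longrightarrow> computable (\<lambda>z. of_bool (P z))"
  by (simp add: decidable_def)

lemma decidable_comp: "decidable P \<Longrightarrow> computable g \<Longrightarrow> decidable (\<lambda>z. P (g z))"
  unfolding decidable_def by (rule computable_comp)

lemma decidable_not [computable_intros]:
  assumes "decidable P"
  shows "decidable (\<lambda>z. \<not> P z)"
proof -
  have eq: "of_bool (\<not> P z) = (1::nat) - of_bool (P z)" for z by simp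
  show ?thesis unfolding decidable_def eq by (intro computable_intros assms)
qed

lemma decidable_conj [computable_intros]:
  assumes "decidable P" "decidable Q"
  shows "decidable (\<lambda>z. P z \<and> Q z)"
proof -
  have eq: "of_bool (P z \<and> Q z) = of_bool (P z) * (of_bool (Q z) :: nat)" for z by simp
  show ?thesis unfolding decidable_def eq by (intro computable_intros assms)
qed

lemma decidable_disj [computable_intros]:
  assumes "decidable P" "decidable Q"
  shows "decidable (\<lambda>z. P z \<or> Q z)"
  using decidable_not[OF decidable_conj[OF decidable_not[OF assms(1)] decidable_not[OF assms(2)]]]
  by simp

lemma decidable_imp [computable_intros]:
  assumes "decidable P" "decidable Q"
  shows "decidable (\<lambda>z. P z \<longrightarrow> Q z)"
  unfolding imp_conv_disj by (intro computable_intros assms)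

lemma decidable_iff [computable_intros]:
  assumes "decidable P" "decidable Q"
  shows "decidable (\<lambda>z. P z \<longleftrightarrow> Q z)"
  unfolding iff_conv_conj_imp by (intro computable_intros assms)

lemma decidable_le [computable_intros]:
  assumes "computable f" "computable g"
  shows "decidable (\<lambda>z. f z \<le> g z)"
proof -
  have eq: "of_bool (f z \<le> g z) = (1::nat) - (f z - g z)" for z by simp
  show ?thesis unfolding decidable_def eq by (intro computable_intros assms)
qed

lemma decidable_less [computable_intros]:
  assumes "computable f" "computable g"
  shows "decidable (\<lambda>z. f z < g z)"
  unfolding less_eq_Suc_le by (intro computable_intros assms)

lemma decidable_eq [computable_intros]:
  assumes "computable f" "computable g"
  shows "decidable (\<lambda>z. f z = g z)"
  unfolding order_eq_iff by (intro computable_intros assms)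

lemma computable_if [computable_intros]:
  assumes "decidable P" "computable f" "computable g"
  shows "computable (\<lambda>z. if P z then f z else g z)"
proof -
  have eq: "(if P z then f z else g z) = of_bool (P z) * f z + of_bool (\<not> P z) * g z" for z
    by simp
  show ?thesis unfolding eq by (intro computable_intros assms)
qed

lemma computable_card [computable_intros]:
  assumes "computable n" "decidable (\<lambda>w. P (pfst w) (psnd w))"
  shows "computable (\<lambda>z. card {k. k < n z \<and> P k z})"
proof -
  have eq: "card {k. k < n z \<and> P k z} = (\<Sum>k<n z. of_bool (P k z))" for z
  proof -
    have "{..<n z} \<inter> {k. P k z} = {k. k < n z \<and> P k z}" by auto
    then show ?thesis by (simp add: sum_of_bool_eq)
  qed
  show ?thesis unfolding eq by (intro computable_intros assms)
qed

lemma decidable_all_less [computable_intros]: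
  assumes "computable n" "decidable (\<lambda>w. P (pfst w) (psnd w))"
  shows "decidable (\<lambda>z. \<forall>k<n z. P k z)"
proof -
  have eq: "(\<forall>k<n z. P k z) \<longleftrightarrow> card {k. k < n z \<and> \<not> P k z} = 0" for z by auto
  show ?thesis unfolding eq by (intro computable_intros assms)
qed

lemma decidable_ex_less [computable_intros]:
  assumes "computable n" "decidable (\<lambda>w. P (pfst w) (psnd w))"
  shows "decidable (\<lambda>z. \<exists>k<n z. P k z)"
proof -
  have eq: "(\<exists>k<n z. P k z) \<longleftrightarrow> \<not> (\<forall>k<n z. \<not> P k z)" for z by auto
  show ?thesis unfolding eq by (intro computable_intros assms)
qed

lemma decidable_ex_le [computable_intros]:
  assumes "computable n" "decidable (\<lambda>w. P (pfst w) (psnd w))"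
  shows "decidable (\<lambda>z. \<exists>k\<le>n z. P k z)"
  unfolding less_Suc_eq_le[symmetric] by (intro computable_intros assms)

lemma computable_div2 [computable_intros]:
  assumes "computable f"
  shows "computable (\<lambda>z. f z div 2)"
proof -
  have eq: "n div 2 = rec_nat 0 (\<lambda>k r. k - r) n" for n :: nat
  proof (induction n)
    case (Suc n)
    \<comment> \<open>\<open>n\<close> is the sum of its lower half \<open>n div 2\<close> and its
      upper half \<open>Suc n div 2\<close>.\<close>
    have "Suc n div 2 = n - n div 2" by presburger
    then show ?case using Suc by simp
  qed simp
  show ?thesis unfolding eq by (intro computable_intros assms)
qed

lemma decidable_even [computable_intros]:
  assumes "computable f"
  shows "decidable (\<lambda>z. even (f z))"
proof -
  have eq: "even n \<longleftrightarrow> n = n div 2 + n div 2" for n :: nat by presburger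
  show ?thesis unfolding eq[of "f _"] by (intro computable_intros assms)
qed

lemma computable_power2 [computable_intros]:
  assumes "computable f"
  shows "computable (\<lambda>z. 2 ^ f z)"
proof -
  have eq: "2 ^ n = rec_nat (1 :: nat) (\<lambda>k r. r + r) n" for n
    by (induction n) auto
  show ?thesis unfolding eq by (intro computable_intros assms)
qed

lemma decidable_set_decode [computable_intros]:
  assumes "computable f" "computable g"
  shows "decidable (\<lambda>z. f z \<in> set_decode (g z))"
proof -
  have eq: "m div 2 ^ n = rec_nat m (\<lambda>k r. r div 2) n" for m n :: nat
    by (induction n) (simp_all only: power.simps nat.rec div_by_1 mult.commute[of 2] div_mult2_eq)
  have eq2: "n \<in> set_decode m \<longleftrightarrow> \<not> even (rec_nat m (\<lambda>k r. r div 2) n)" for m n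
    by (simp only: set_decode_def eq mem_Collect_eq)
  show ?thesis unfolding eq2 by (intro computable_intros assms)
qed

subsection \<open>Coded lists\<close>

definition lhd :: "nat \<Rightarrow> nat" where "lhd n = pfst (n - 1)"

definition ltl :: "nat \<Rightarrow> nat" where "ltl n = psnd (n - 1)"

definition lnth :: "nat \<Rightarrow> nat \<Rightarrow> nat" where "lnth n k = lhd (rec_nat n (\<lambda>_. ltl) k)"

text \<open>Counts the iterated tails that are still nonempty. The bound \<open>n\<close> suffices
  because a list code is at least the length of the list.\<close>

definition llength :: "nat \<Rightarrow> nat" where "llength n = card {k. k < n \<and> rec_nat n (\<lambda>_. ltl) k \<noteq> 0}"

lemma lhd_list_encode [simp]: "lhd (list_encode (x # xs)) = x"
  by (simp add: lhd_def)

lemma ltl_list_encode [simp]: "ltl (list_encode xs) = list_encode (tl xs)"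
  \<comment> \<open>For the empty list, \<open>ltl 0 = psnd 0 = 0\<close> matches
    \<open>tl [] = []\<close>.\<close>
  using psnd_le[of 0] by (cases xs) (auto simp: ltl_def)

lemma ltl_iterate: "rec_nat (list_encode xs) (\<lambda>_. ltl) k = list_encode (drop k xs)"
  by (induction k) (simp_all add: drop_Suc tl_drop)

lemma lnth_list_encode [simp]: "k < length xs \<Longrightarrow> lnth (list_encode xs) k = xs ! k"
  by (simp add: lnth_def ltl_iterate flip: Cons_nth_drop_Suc del: list_encode.simps)

lemma length_le_list_encode: "length xs \<le> list_encode xs"
  by (induction xs) (use le_prod_encode_2 order_trans in fastforce)+

lemma list_encode_eq_0 [simp]: "list_encode xs = 0 \<longleftrightarrow> xs = []"
  by (cases xs) auto

lemma llength_list_encode [simp]: "llength (list_encode xs) = length xs"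
proof -
  have "{k. k < list_encode xs \<and> rec_nat (list_encode xs) (\<lambda>_. ltl) k \<noteq> 0} = {..<length xs}"
    using length_le_list_encode[of xs] by (auto simp: ltl_iterate)
  then show ?thesis by (simp add: llength_def)
qed

lemma computable_lhd: "computable lhd"
  unfolding lhd_def[abs_def] by (intro computable_intros)

lemma computable_ltl: "computable ltl"
  unfolding ltl_def[abs_def] by (intro computable_intros)

lemmas [computable_intros] =
  computable_lhd[THEN computable_comp] computable_ltl[THEN computable_comp]

lemma computable2_lnth: "computable2 lnth"
  unfolding lnth_def[abs_def] by (intro computable2I computable_intros)

lemma computable_llength: "computable llength"
  unfolding llength_def[abs_def] by (intro computable_intros)

lemmas [computable_intros] =
  computable2_lnth[THEN computable_comp2] computable_llength[THEN computable_comp]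

section \<open>A stagewise enumeration of all computations\<close>

lemma list_decode_le: "x \<in> set (list_decode n) \<Longrightarrow> x \<le> n"
proof (induction n rule: list_decode.induct)
  case (2 n)
  then show ?case
    using pfst_le[of n] psnd_le[of n]
    by (cases "prod_decode n") (force simp: pfst_def psnd_def)
qed simp

text \<open>Used for termination of \<open>recf_of\<close>, whose recursive calls all sit under a
  positive tag.\<close>

lemma psnd_less: "0 < pfst q \<Longrightarrow> psnd q < q"
proof -
  assume "0 < pfst q"
  then have "psnd q < pair (pfst q) (psnd q)"
    using diagonal_bounds[of "pair (pfst q) (psnd q)"]
    by (cases "pfst q") (auto simp: prod_encode_def)
  then show ?thesis by simp
qed

text \<open>All tags above \<open>4\<close> are read as \<open>Mn\<close>, so every number is a
  program. Repeated programs are harmless here, since repetitions of graphs are eliminated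
  later.\<close>

function recf_of :: "nat \<Rightarrow> recf" where
  "recf_of q =
    (if pfst q = 0 then Z
     else if pfst q = 1 then S
     else if pfst q = 2 then Id (psnd q)
     else if pfst q = 3 then
       Cn (recf_of (pfst (psnd q))) (map recf_of (list_decode (psnd (psnd q))))
     else if pfst q = 4 then Pr (recf_of (pfst (psnd q))) (recf_of (psnd (psnd q)))
     else Mn (recf_of (psnd q)))"
  by auto
termination
proof (relation "measure id", goal_cases)
  case (3 q x)
  then show ?case
    using psnd_less[of q] psnd_le[of "psnd q"] list_decode_le[of x "psnd (psnd q)"] by auto
qed (auto intro: psnd_less le_less_trans[OF pfst_le psnd_less] le_less_trans[OF psnd_le psnd_less])

declare recf_of.simps [simp del]

lemma recf_of_cases:
  "recf_of q = Z \<longleftrightarrow> pfst q = 0"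
  "recf_of q = S \<longleftrightarrow> pfst q = 1"
  "recf_of q = Id i \<longleftrightarrow> pfst q = 2 \<and> psnd q = i"
  "recf_of q = Cn f gs \<longleftrightarrow> pfst q = 3 \<and> recf_of (pfst (psnd q)) = f \<and>
     map recf_of (list_decode (psnd (psnd q))) = gs"
  "recf_of q = Pr f g \<longleftrightarrow> pfst q = 4 \<and> recf_of (pfst (psnd q)) = f \<and> recf_of (psnd (psnd q)) = g"
  "recf_of q = Mn f \<longleftrightarrow> 4 < pfst q \<and> recf_of (psnd q) = f"
  by (subst recf_of.simps; auto)+

lemma recf_of_surj: "\<exists>q. recf_of q = t"
proof (induction t)
  case (Cn f gs)
  then obtain q where q: "recf_of q = f" by blast
  have "\<exists>h. \<forall>g\<in>set gs. recf_of (h g) = g" using Cn(2) by metis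
  then obtain h where "\<forall>g\<in>set gs. recf_of (h g) = g" by blast
  then have "map recf_of (map h gs) = gs" by (simp add: map_idI)
  then have "recf_of (pair 3 (pair q (list_encode (map h gs)))) = Cn f gs"
    using q by (simp add: recf_of_cases)
  then show ?case by blast
next
  case Z
  have "recf_of (pair 0 0) = Z" by (simp add: recf_of_cases)
  then show ?case by blast
next
  case S
  have "recf_of (pair 1 0) = S" by (simp add: recf_of_cases)
  then show ?case by blast
next
  case (Id i)
  have "recf_of (pair 2 i) = Id i" by (simp add: recf_of_cases)
  then show ?case by blast
next
  case (Pr f g)
  then obtain p q where "recf_of p = f" "recf_of q = g" by blast
  then have "recf_of (pair 4 (pair p q)) = Pr f g" by (simp add: recf_of_cases)
  then show ?case by blast
next
  case (Mn f)
  then obtain q where "recf_of q = f" by blast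
  then have "recf_of (pair 5 q) = Mn f" by (simp add: recf_of_cases)
  then show ?case by blast
qed

definition lcons :: "nat \<Rightarrow> nat \<Rightarrow> nat" where "lcons x a = Suc (pair x a)"

lemma list_decode_lcons [simp]: "list_decode (lcons x a) = x # list_decode a"
  by (simp add: lcons_def)

lemma lcons_list_encode [simp]: "lcons x (list_encode xs) = list_encode (x # xs)"
  by (simp add: lcons_def)

section \<open>Coded derivations of evaluation judgements\<close>

definition judgement :: "nat \<Rightarrow> nat \<Rightarrow> nat \<Rightarrow> nat" where
  "judgement q a y = pair q (pair a y)"

definition holds :: "nat \<Rightarrow> bool" where
  "holds j \<longleftrightarrow> eval (recf_of (pfst j)) (list_decode (pfst (psnd j))) (psnd (psnd j))"

lemma holds_judgement [simp]: "holds (judgement q a y) \<longleftrightarrow> eval (recf_of q) (list_decode a) y"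
  by (simp add: holds_def judgement_def)

text \<open>The rules of \<^const>\<open>eval\<close> on codes, with premises looked up in the finite set coded by \<open>d\<close>.
  The witness \<open>w\<close> holds the values that occur in the premises but not in the conclusion.\<close>

definition derives :: "nat \<Rightarrow> nat \<Rightarrow> nat \<Rightarrow> nat \<Rightarrow> nat \<Rightarrow> bool" where
  "derives d w q a y \<longleftrightarrow>
     pfst q = 0 \<and> y = 0 \<or>
     pfst q = 1 \<and> llength a = 1 \<and> y = Suc (lnth a 0) \<or>
     pfst q = 2 \<and> psnd q < llength a \<and> y = lnth a (psnd q) \<or>
     pfst q = 3 \<and> llength w = llength (psnd (psnd q)) \<and>
       (\<forall>k<llength w. judgement (lnth (psnd (psnd q)) k) a (lnth w k) \<in> set_decode d) \<and>
       judgement (pfst (psnd q)) w y \<in> set_decode d \<or>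
     pfst q = 4 \<and> 0 < llength a \<and> lhd a = 0 \<and>
       judgement (pfst (psnd q)) (ltl a) y \<in> set_decode d \<or>
     pfst q = 4 \<and> 0 < llength a \<and> 0 < lhd a \<and>
       judgement q (lcons (lhd a - 1) (ltl a)) w \<in> set_decode d \<and>
       judgement (psnd (psnd q)) (lcons (lhd a - 1) (lcons w (ltl a))) y \<in> set_decode d \<or>
     4 < pfst q \<and> judgement (psnd q) (lcons y a) 0 \<in> set_decode d \<and>
       (\<forall>k<y. lnth w k \<noteq> 0 \<and> judgement (psnd q) (lcons k a) (lnth w k) \<in> set_decode d)"

lemma derives_sound:
  assumes d: "\<And>j. j \<in> set_decode d \<Longrightarrow> holds j" and "derives d w q a y"
  shows "eval (recf_of q) (list_decode a) y"
proof -
  have d': "eval (recf_of p) (list_decode b) z" if "judgement p b z \<in> set_decode d" for p b z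
    using d[OF that] by simp
  define xs where "xs = list_decode a"
  then have a: "a = list_encode xs" by simp
  consider (Z) "pfst q = 0" "y = 0"
    | (S) "pfst q = 1" "length xs = 1" "y = Suc (xs ! 0)"
    | (Id) "pfst q = 2" "psnd q < length xs" "y = xs ! psnd q"
    | (Cn) "pfst q = 3" "llength w = llength (psnd (psnd q))"
        "\<forall>k<llength w. judgement (lnth (psnd (psnd q)) k) a (lnth w k) \<in> set_decode d"
        "judgement (pfst (psnd q)) w y \<in> set_decode d"
    | (Pr0) "pfst q = 4" "xs \<noteq> []" "lhd a = 0"
        "judgement (pfst (psnd q)) (ltl a) y \<in> set_decode d"
    | (PrS) "pfst q = 4" "xs \<noteq> []" "0 < lhd a"
        "judgement q (lcons (lhd a - 1) (ltl a)) w \<in> set_decode d"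
        "judgement (psnd (psnd q)) (lcons (lhd a - 1) (lcons w (ltl a))) y \<in> set_decode d"
    | (Mn) "4 < pfst q" "judgement (psnd q) (lcons y a) 0 \<in> set_decode d"
        "\<forall>k<y. lnth w k \<noteq> 0 \<and> judgement (psnd q) (lcons k a) (lnth w k) \<in> set_decode d"
    using assms(2) unfolding derives_def a by auto
  then have "eval (recf_of q) xs y"
  proof cases
    case Z
    then have "recf_of q = recf.Z" by (simp add: recf_of_cases)
    then show ?thesis using Z by (simp add: eval_Z)
  next
    case S
    then have "recf_of q = recf.S" by (simp add: recf_of_cases)
    then show ?thesis using S by (auto simp: length_Suc_conv intro: eval_S)
  next
    case Id
    then have "recf_of q = recf.Id (psnd q)" by (simp add: recf_of_cases)
    then show ?thesis using Id by (simp add: eval_Id)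
  next
    case Cn
    define ys where "ys = list_decode w"
    define qs where "qs = list_decode (psnd (psnd q))"
    have w: "w = list_encode ys" and qs: "psnd (psnd q) = list_encode qs"
      by (simp_all add: ys_def qs_def)
    have q: "recf_of q = recf.Cn (recf_of (pfst (psnd q))) (map recf_of qs)"
      using Cn by (simp add: recf_of_cases qs_def)
    have len: "length ys = length qs" using Cn(2) by (simp add: w qs)
    have "list_all2 (\<lambda>g y. eval g xs y) (map recf_of qs) ys"
      using Cn(3) len by (auto simp: list_all2_conv_all_nth w qs a dest!: d')
    moreover have "eval (recf_of (pfst (psnd q))) ys y" using d'[OF Cn(4)] by (simp add: w)
    ultimately show ?thesis unfolding q by (rule eval_Cn)
  next
    case Pr0
    then obtain ys where ys: "xs = 0 # ys" by (cases xs) (auto simp: a simp del: list_encode.simps)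
    have q: "recf_of q = recf.Pr (recf_of (pfst (psnd q))) (recf_of (psnd (psnd q)))"
      using Pr0 by (simp add: recf_of_cases)
    have "eval (recf_of (pfst (psnd q))) ys y"
      using d'[OF Pr0(4)] by (simp add: a ys del: list_encode.simps)
    then show ?thesis unfolding q ys by (rule eval_Pr0)
  next
    case PrS
    then obtain x ys where ys: "xs = Suc x # ys"
      by (cases xs; cases "hd xs") (auto simp: a simp del: list_encode.simps)
    have q: "recf_of q = recf.Pr (recf_of (pfst (psnd q))) (recf_of (psnd (psnd q)))"
      using PrS by (simp add: recf_of_cases)
    have "eval (recf_of q) (x # ys) w"
      using d'[OF PrS(4)] by (simp add: a ys del: list_encode.simps)
    moreover have "eval (recf_of (psnd (psnd q))) (x # w # ys) y"
      using d'[OF PrS(5)] by (simp add: a ys del: list_encode.simps)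
    ultimately show ?thesis using q eval_PrS ys by metis
  next
    case Mn
    then have q: "recf_of q = recf.Mn (recf_of (psnd q))" by (simp add: recf_of_cases)
    have "eval (recf_of (psnd q)) (y # xs) 0" using d'[OF Mn(2)] by (simp add: a)
    moreover have "\<forall>k<y. \<exists>v. v \<noteq> 0 \<and> eval (recf_of (psnd q)) (k # xs) v"
      using Mn(3) by (fastforce simp: a dest: d')
    ultimately show ?thesis unfolding q by (rule eval_Mn)
  qed
  then show ?thesis by (simp add: xs_def)
qed

text \<open>The set coded by \<open>d\<close> occurs only positively in the rules.\<close>

lemma derives_mono: "derives d w q a y \<Longrightarrow> set_decode d \<subseteq> set_decode d' \<Longrightarrow> derives d' w q a y"
  unfolding derives_def subset_iff by (elim disjE; simp)

text \<open>Stage \<open>s\<close> tries to derive the judgement \<open>pfst (psnd s)\<close> with witness \<open>psnd (psnd s)\<close>;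
  the component \<open>pfst s\<close> makes every such attempt recur at arbitrarily late stages.\<close>

fun derived :: "nat \<Rightarrow> nat" where
  "derived 0 = 0"
| "derived (Suc s) =
    (if derives (derived s) (psnd (psnd s)) (pfst (pfst (psnd s)))
          (pfst (psnd (pfst (psnd s)))) (psnd (psnd (pfst (psnd s)))) \<and>
        pfst (psnd s) \<notin> set_decode (derived s)
     then 2 ^ pfst (psnd s) + derived s else derived s)"

lemma derived_Suc_subset: "set_decode (derived s) \<subseteq> set_decode (derived (Suc s))"
  by (auto simp: set_decode_plus_power_2)

lemma derived_mono: "s \<le> s' \<Longrightarrow> set_decode (derived s) \<subseteq> set_decode (derived s')"
  using lift_Suc_mono_le[of "\<lambda>s. set_decode (derived s)"] derived_Suc_subset by blast

lemma derived_Suc_new: "set_decode (derived (Suc s)) \<subseteq> insert (pfst (psnd s)) (set_decode (derived s))"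
  by (auto simp: set_decode_plus_power_2)

text \<open>Stage \<open>s\<close> can only add the number \<open>pfst (psnd s)\<close>, which is at
  most \<open>s\<close>. This is what keeps approximations finite and searches through them
  bounded.\<close>

lemma derived_bound: "j \<in> set_decode (derived s) \<Longrightarrow> j < s"
proof (induction s)
  case (Suc s)
  have "pfst (psnd s) \<le> s" using pfst_le psnd_le order_trans by blast
  with Suc show ?case using derived_Suc_new[of s] less_SucI by fastforce
qed simp

lemma derived_sound: "j \<in> set_decode (derived s) \<Longrightarrow> holds j"
proof (induction s arbitrary: j)
  case (Suc s)
  show ?case
  proof (cases "j \<in> set_decode (derived s)")
    case False
    with Suc.prems have "j = pfst (psnd s)" and
      "derives (derived s) (psnd (psnd s)) (pfst j) (pfst (psnd j)) (psnd (psnd j))"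
      using derived_Suc_new[of s] by (auto split: if_splits)
    with derives_sound[OF Suc.IH] show ?thesis unfolding holds_def by blast
  qed (rule Suc.IH)
qed simp

lemma derived_step:
  assumes "derives (derived s) w q a y"
  shows "\<exists>s. judgement q a y \<in> set_decode (derived s)"
proof -
  \<comment> \<open>A stage no earlier than \<open>s\<close> at which exactly this judgement is
    tried with witness \<open>w\<close>.\<close>
  let ?s = "pair s (pair (judgement q a y) w)"
  have "derives (derived ?s) w q a y"
    by (rule derives_mono[OF assms derived_mono]) (rule le_prod_encode_1)
  then have "judgement q a y \<in> set_decode (derived (Suc ?s))"
    by (auto simp: judgement_def set_decode_plus_power_2)
  then show ?thesis by blast
qed

lemma finite_subset_increasing_Union:
  fixes A :: "nat \<Rightarrow> 'a set"
  assumes "\<And>s s'. s \<le> s' \<Longrightarrow> A s \<subseteq> A s'" "finite F" "F \<subseteq> (\<Union>s. A s)"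
  shows "\<exists>s. F \<subseteq> A s"
  using assms(2,3)
proof (induction F)
  case (insert x F)
  then obtain s s' where "F \<subseteq> A s" "x \<in> A s'" by auto
  then have "insert x F \<subseteq> A (max s s')"
    using assms(1)[of s "max s s'"] assms(1)[of s' "max s s'"] by auto
  then show ?case by blast
qed simp

lemma finite_subset_derived:
  assumes "finite J" "\<And>j. j \<in> J \<Longrightarrow> \<exists>s. j \<in> set_decode (derived s)"
  shows "\<exists>s. J \<subseteq> set_decode (derived s)"
  using assms by (intro finite_subset_increasing_Union derived_mono) auto

text \<open>Every rule instance has finitely many premises, so a single stage contains them all. The
  witness is the list of inner values for \<open>Cn\<close>, the previous value for
  \<open>Pr\<close>, and the list of nonzero values below the result for \<open>Mn\<close>.\<close>

lemma derived_complete: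
  "eval t xs y \<Longrightarrow> recf_of q = t \<Longrightarrow> \<exists>s. judgement q (list_encode xs) y \<in> set_decode (derived s)"
proof (induction arbitrary: q rule: eval.induct)
  case (eval_Z xs)
  then have "derives (derived 0) 0 q (list_encode xs) 0"
    by (simp add: recf_of_cases derives_def)
  then show ?case by (rule derived_step)
next
  case (eval_S x)
  then have "derives (derived 0) 0 q (list_encode [x]) (Suc x)"
    by (simp add: recf_of_cases derives_def del: list_encode.simps)
  then show ?case by (rule derived_step)
next
  case (eval_Id i xs)
  then have "derives (derived 0) 0 q (list_encode xs) (xs ! i)"
    by (simp add: recf_of_cases derives_def)
  then show ?case by (rule derived_step)
next
  case (eval_Cn xs gs ys f z)
  define qs where "qs = list_decode (psnd (psnd q))"
  have qs: "psnd (psnd q) = list_encode qs" by (simp add: qs_def)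
  from eval_Cn.prems have q: "pfst q = 3" "recf_of (pfst (psnd q)) = f" "gs = map recf_of qs"
    by (auto simp: recf_of_cases qs_def)
  have len: "length ys = length qs" using list_all2_lengthD[OF eval_Cn.IH(1)] q by simp
  let ?J = "insert (judgement (pfst (psnd q)) (list_encode ys) z)
    ((\<lambda>k. judgement (qs ! k) (list_encode xs) (ys ! k)) ` {..<length ys})"
  have "\<exists>s. ?J \<subseteq> set_decode (derived s)"
  proof (rule finite_subset_derived)
    fix j assume "j \<in> ?J"
    then show "\<exists>s. j \<in> set_decode (derived s)"
    proof
      assume "j = judgement (pfst (psnd q)) (list_encode ys) z"
      then show ?thesis using eval_Cn.IH(2)[OF q(2)] by simp
    next
      assume "j \<in> (\<lambda>k. judgement (qs ! k) (list_encode xs) (ys ! k)) ` {..<length ys}"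
      then obtain k where k: "k < length ys" "j = judgement (qs ! k) (list_encode xs) (ys ! k)"
        by auto
      then show ?thesis
        using list_all2_nthD2[OF eval_Cn.IH(1) k(1)] q(3) len by auto
    qed
  qed simp
  then obtain s where "?J \<subseteq> set_decode (derived s)" by blast
  then have "derives (derived s) (list_encode ys) q (list_encode xs) z"
    using q len by (auto simp: derives_def qs)
  then show ?case by (rule derived_step)
next
  case (eval_Pr0 f xs y g)
  then have q: "pfst q = 4" "recf_of (pfst (psnd q)) = f" by (auto simp: recf_of_cases)
  obtain s where "judgement (pfst (psnd q)) (list_encode xs) y \<in> set_decode (derived s)"
    using eval_Pr0.IH[OF q(2)] by blast
  then have "derives (derived s) 0 q (list_encode (0 # xs)) y"
    using q by (simp add: derives_def del: list_encode.simps)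
  then show ?case by (rule derived_step)
next
  case (eval_PrS f g x xs y z)
  then have q: "pfst q = 4" "recf_of (psnd (psnd q)) = g" by (auto simp: recf_of_cases)
  let ?J = "{judgement q (list_encode (x # xs)) y,
    judgement (psnd (psnd q)) (list_encode (x # y # xs)) z}"
  have "\<exists>s. ?J \<subseteq> set_decode (derived s)"
    using eval_PrS.IH(1)[OF eval_PrS.prems] eval_PrS.IH(2)[OF q(2)]
    by (intro finite_subset_derived) auto
  then obtain s where "?J \<subseteq> set_decode (derived s)" by blast
  then have "derives (derived s) y q (list_encode (Suc x # xs)) z"
    using q by (simp add: derives_def del: list_encode.simps)
  then show ?case by (rule derived_step)
next
  case (eval_Mn f x xs)
  then have q: "4 < pfst q" "recf_of (psnd q) = f" by (auto simp: recf_of_cases)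
  obtain v where v: "\<And>k. k < x \<Longrightarrow> v k \<noteq> 0 \<and>
      (\<exists>s. judgement (psnd q) (list_encode (k # xs)) (v k) \<in> set_decode (derived s))"
    using eval_Mn.IH(2) q(2) by metis
  let ?J = "insert (judgement (psnd q) (list_encode (x # xs)) 0)
    ((\<lambda>k. judgement (psnd q) (list_encode (k # xs)) (v k)) ` {..<x})"
  have "\<exists>s. ?J \<subseteq> set_decode (derived s)"
    using eval_Mn.IH(1)[OF q(2)] v
    by (intro finite_subset_derived) (auto simp del: list_encode.simps)
  then obtain s where "?J \<subseteq> set_decode (derived s)" by blast
  then have "derives (derived s) (list_encode (map v [0..<x])) q (list_encode xs) x"
    using q v by (auto simp: derives_def simp del: list_encode.simps)
  then show ?case by (rule derived_step)
qed

lemma computable_derived: "computable derived"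
proof -
  have eq: "derived s = rec_nat 0 (\<lambda>s d.
      if derives d (psnd (psnd s)) (pfst (pfst (psnd s)))
          (pfst (psnd (pfst (psnd s)))) (psnd (psnd (pfst (psnd s)))) \<and>
        pfst (psnd s) \<notin> set_decode d
      then 2 ^ pfst (psnd s) + d else d) s" for s
    by (induction s) (simp_all only: derived.simps nat.rec)
  show ?thesis
    unfolding eq[abs_def] derives_def judgement_def lcons_def by (intro computable_intros)
qed

text \<open>Partial functions are represented by their graphs, viewed as single-valued sets of coded
  pairs; \<open>approx i s\<close> is the part of the \<open>i\<close>-th graph found before stage \<open>s\<close>.\<close>

definition approx :: "nat \<Rightarrow> nat \<Rightarrow> nat set" where
  "approx i s = {p. judgement i (lcons (pfst p) 0) (psnd p) \<in> set_decode (derived s)}"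

definition single_valued_code :: "nat set \<Rightarrow> bool" where
  "single_valued_code X \<longleftrightarrow> (\<forall>p\<in>X. \<forall>q\<in>X. pfst p = pfst q \<longrightarrow> p = q)"

lemma approx_mono: "s \<le> s' \<Longrightarrow> approx i s \<subseteq> approx i s'"
  using derived_mono unfolding approx_def by blast

lemma prod_encode_mono: "a \<le> a' \<Longrightarrow> b \<le> b' \<Longrightarrow> pair a b \<le> pair a' b'"
  unfolding prod_encode_def by (auto intro!: add_mono triangle_mono)

lemma approx_bound: "p \<in> approx i s \<Longrightarrow> p < s"
proof -
  assume "p \<in> approx i s"
  then have "judgement i (lcons (pfst p) 0) (psnd p) < s"
    unfolding approx_def using derived_bound by blast
  moreover have "pair (pfst p) (psnd p) \<le> pair (lcons (pfst p) 0) (psnd p)"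
    unfolding lcons_def by (intro prod_encode_mono le_SucI le_prod_encode_1 order_refl)
  then have "p \<le> judgement i (lcons (pfst p) 0) (psnd p)"
    unfolding judgement_def using le_prod_encode_2 order_trans by (metis pair_pfst_psnd)
  ultimately show ?thesis by simp
qed

lemma finite_approx: "finite (approx i s)"
  by (rule finite_subset[of _ "{..<s}"]) (auto dest: approx_bound)

lemma approx_0: "approx i 0 = {}"
  using approx_bound by blast

text \<open>A stage adds at most one judgement, and the judgement determines the point.\<close>

lemma approx_Suc: "\<exists>p. approx i (Suc s) \<subseteq> insert p (approx i s)"
proof (cases "approx i (Suc s) \<subseteq> approx i s")
  case False
  then obtain p where p: "p \<in> approx i (Suc s)" "p \<notin> approx i s" by blast
  have new: "judgement i (lcons (pfst q) 0) (psnd q) = pfst (psnd s)"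
    if "q \<in> approx i (Suc s)" "q \<notin> approx i s" for q
    using that derived_Suc_new[of s] unfolding approx_def mem_Collect_eq by (meson insertE subsetD)
  have "q = p" if "q \<in> approx i (Suc s)" "q \<notin> approx i s" for q
  proof -
    have "judgement i (lcons (pfst q) 0) (psnd q) = judgement i (lcons (pfst p) 0) (psnd p)"
      by (simp only: new[OF that] new[OF p])
    then have "pfst q = pfst p \<and> psnd q = psnd p" by (simp add: judgement_def lcons_def)
    then show ?thesis by (metis pair_pfst_psnd)
  qed
  then show ?thesis by blast
qed auto

lemma Union_approx: "(\<Union>s. approx i s) = {p. eval (recf_of i) [pfst p] (psnd p)}"
proof (intro set_eqI iffI)
  fix p assume "p \<in> (\<Union>s. approx i s)"
  then have "holds (judgement i (lcons (pfst p) 0) (psnd p))"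
    unfolding approx_def using derived_sound by blast
  then show "p \<in> {p. eval (recf_of i) [pfst p] (psnd p)}" by simp
next
  fix p assume "p \<in> {p. eval (recf_of i) [pfst p] (psnd p)}"
  then have "\<exists>s. judgement i (list_encode [pfst p]) (psnd p) \<in> set_decode (derived s)"
    by (intro derived_complete) auto
  then show "p \<in> (\<Union>s. approx i s)" by (simp add: approx_def lcons_def)
qed

lemma single_valued_Union_approx: "single_valued_code (\<Union>s. approx i s)"
  unfolding single_valued_code_def Union_approx
  by (metis eval_deterministic mem_Collect_eq pair_pfst_psnd)

lemma decidable_approx [computable_intros]:
  assumes "computable f" "computable g" "computable h"
  shows "decidable (\<lambda>z. f z \<in> approx (g z) (h z))"
  unfolding approx_def judgement_def lcons_def mem_Collect_eq
  by (intro computable_intros assms computable_comp[OF computable_derived])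

section \<open>An enumeration without repetition\<close>

subsection \<open>Graphs that are infinite or of even cardinality\<close>

text \<open>Freezes the approximation at its last even size up to stage \<open>s\<close>. Points
  arrive one at a time, so a finite graph of odd size is cut back by one point, and all other graphs
  survive unchanged.\<close>

definition even_approx :: "nat \<Rightarrow> nat \<Rightarrow> nat set" where
  "even_approx i s = {p. \<exists>u\<le>s. even (card (approx i u)) \<and> p \<in> approx i u}"

definition even_graph :: "nat \<Rightarrow> nat set" where
  "even_graph i = (\<Union>s. even_approx i s)"

lemma even_approx_mono: "s \<le> s' \<Longrightarrow> even_approx i s \<subseteq> even_approx i s'"
  unfolding even_approx_def by (auto intro: order_trans)

lemma even_approx_bound: "p \<in> even_approx i s \<Longrightarrow> p < s"
  unfolding even_approx_def using approx_bound order_less_le_trans by blast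

lemma finite_even_approx: "finite (even_approx i s)"
  by (rule finite_subset[of _ "{..<s}"]) (auto dest: even_approx_bound)

lemma even_approx_subset_graph: "even_approx i s \<subseteq> even_graph i"
  unfolding even_graph_def by blast

lemma even_graph_subset: "even_graph i \<subseteq> (\<Union>s. approx i s)"
  unfolding even_graph_def even_approx_def by blast

text \<open>By monotonicity the union is its last member. Stage \<open>0\<close>, with the empty
  approximation, guarantees that there is one.\<close>

lemma even_card_even_approx: "even (card (even_approx i s))"
proof -
  let ?U = "{u. u \<le> s \<and> even (card (approx i u))}"
  have fin: "finite ?U" and "0 \<in> ?U" by (auto simp: approx_0)
  then have max: "Max ?U \<in> ?U" by (intro Max_in) auto
  have "even_approx i s = approx i (Max ?U)"
  proof
    show "even_approx i s \<subseteq> approx i (Max ?U)"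
      unfolding even_approx_def using approx_mono Max_ge[OF fin] by blast
    show "approx i (Max ?U) \<subseteq> even_approx i s"
      unfolding even_approx_def using max by blast
  qed
  then show ?thesis using max by simp
qed

lemma finite_subset_even_graph:
  "finite F \<Longrightarrow> F \<subseteq> even_graph i \<Longrightarrow> \<exists>s. F \<subseteq> even_approx i s"
  unfolding even_graph_def by (rule finite_subset_increasing_Union[OF even_approx_mono])

lemma infinite_or_even_even_graph: "infinite (even_graph i) \<or> even (card (even_graph i))"
proof (cases "finite (even_graph i)")
  case True
  then obtain s where "even_graph i \<subseteq> even_approx i s"
    using finite_subset_even_graph by blast
  then have "even_graph i = even_approx i s" using even_approx_subset_graph by blast
  then show ?thesis by (simp add: even_card_even_approx)
qed simp

text \<open>Stages add points one at a time, so an approximation cannot skip an even cardinality.\<close>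

lemma odd_card_approx_constant:
  assumes "\<And>u. s \<le> u \<Longrightarrow> odd (card (approx i u))" "s \<le> u"
  shows "approx i u = approx i s"
  using assms(2)
proof (induction u rule: dec_induct)
  case (step u)
  obtain p where p: "approx i (Suc u) \<subseteq> insert p (approx i u)" using approx_Suc by blast
  have sub: "approx i u \<subseteq> approx i (Suc u)" by (rule approx_mono) simp
  have odd: "odd (card (approx i u))" "odd (card (approx i (Suc u)))"
    using assms(1) step.hyps by auto
  have "approx i (Suc u) = approx i u"
  proof (rule ccontr)
    assume "approx i (Suc u) \<noteq> approx i u"
    then have "approx i (Suc u) = insert p (approx i u)" "p \<notin> approx i u" using p sub by auto
    then show False using odd finite_approx by simp
  qed
  then show ?case using step.IH by simp
qed simp

text \<open>If only odd sizes occurred from some stage on, the approximation would be constant from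
  there and the whole graph finite of odd size.\<close>

lemma even_graph_eq:
  assumes "infinite (\<Union>s. approx i s) \<or> even (card (\<Union>s. approx i s))"
  shows "even_graph i = (\<Union>s. approx i s)"
proof
  show "(\<Union>s. approx i s) \<subseteq> even_graph i"
  proof (rule UN_least)
    fix s
    have "\<exists>u\<ge>s. even (card (approx i u))"
    proof (rule ccontr)
      assume odd: "\<not> ?thesis"
      then have "approx i u = approx i s" if "s \<le> u" for u
        using odd_card_approx_constant that by blast
      moreover have "approx i u \<subseteq> approx i s" if "u \<le> s" for u
        using approx_mono that by blast
      ultimately have "(\<Union>s. approx i s) = approx i s" using nat_le_linear by blast
      with assms odd finite_approx show False by auto
    qed
    then obtain u where u: "s \<le> u" "even (card (approx i u))" by blast
    have "approx i s \<subseteq> approx i u" by (rule approx_mono[OF u(1)])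
    then show "approx i s \<subseteq> even_graph i"
      using u(2) unfolding even_graph_def even_approx_def by blast
  qed
qed (rule even_graph_subset)

lemma single_valued_code_subset: "single_valued_code Y \<Longrightarrow> X \<subseteq> Y \<Longrightarrow> single_valued_code X"
  unfolding single_valued_code_def by blast

lemma single_valued_even_graph: "single_valued_code (even_graph i)"
  by (rule single_valued_code_subset[OF single_valued_Union_approx even_graph_subset])

lemma decidable_even_approx [computable_intros]:
  assumes "computable f" "computable g" "computable h"
  shows "decidable (\<lambda>z. f z \<in> even_approx (g z) (h z))"
proof -
  have eq: "card (approx i u) = card {k. k < u \<and> k \<in> approx i u}" for i u
    by (rule arg_cong[of _ _ card]) (auto dest: approx_bound)
  have "decidable (\<lambda>w. pfst w \<in> even_approx (pfst (psnd w)) (psnd (psnd w)))"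
    unfolding even_approx_def mem_Collect_eq eq by (intro computable_intros)
  from decidable_comp[OF this, of "\<lambda>z. pair (f z) (pair (g z) (h z))"] show ?thesis
    by (simp add: assms computable_intros)
qed

subsection \<open>Guessing least indices\<close>

text \<open>The bound \<open>p < s\<close> makes the comparison decidable and loses nothing, because
  approximations at stage \<open>s\<close> lie below \<open>s\<close>.\<close>

definition agree :: "nat \<Rightarrow> nat \<Rightarrow> nat \<Rightarrow> nat \<Rightarrow> bool" where
  "agree j i b s \<longleftrightarrow>
     (\<forall>p<s. pfst p < b \<longrightarrow> (p \<in> even_approx j s \<longleftrightarrow> p \<in> even_approx i s))"

text \<open>Stage \<open>s\<close> rejects the bound \<open>b\<close> for \<open>i\<close> if below \<open>b\<close> the \<open>i\<close>-th graph looks like an earlier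
  one or like a constant function. All bounds get rejected iff \<open>i\<close> is superfluous.\<close>

definition rejects :: "nat \<Rightarrow> nat \<Rightarrow> nat \<Rightarrow> bool" where
  "rejects i b s \<longleftrightarrow> b \<le> s \<and>
     ((\<exists>j<i. agree j i b s) \<or>
      (\<exists>c\<le>s. \<forall>x<b. pair x c \<in> even_approx i s))"

definition rejected :: "nat \<Rightarrow> nat \<Rightarrow> bool" where
  "rejected i b \<longleftrightarrow> (\<exists>s. rejects i b s)"

definition first_rejects :: "nat \<Rightarrow> nat \<Rightarrow> nat \<Rightarrow> bool" where
  "first_rejects i b s \<longleftrightarrow> rejects i b s \<and> (\<forall>u<s. \<not> rejects i b u)"

definition constant_graph :: "nat set \<Rightarrow> bool" where
  "constant_graph X \<longleftrightarrow> (\<exists>c. \<forall>x. pair x c \<in> X)"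

definition needed :: "nat \<Rightarrow> bool" where
  "needed i \<longleftrightarrow> (\<forall>j<i. even_graph j \<noteq> even_graph i) \<and> \<not> constant_graph (even_graph i)"

text \<open>Consequently the rejected bounds form an initial segment, and an index with some
  unrejected bound has a unique last rejected one.\<close>

lemma rejects_antimono: "rejects i b s \<Longrightarrow> b' \<le> b \<Longrightarrow> rejects i b' s"
  unfolding rejects_def agree_def by (meson order_trans order_less_le_trans)

text \<open>Below the bound \<open>0\<close> every graph looks constant vacuously. This starts the
  initial segment of rejected bounds for every index.\<close>

lemma rejected_0: "rejected i 0"
  unfolding rejected_def rejects_def by blast

lemma rejected_iff_first: "rejected i b \<longleftrightarrow> (\<exists>s. first_rejects i b s)"
  unfolding rejected_def first_rejects_def by (rule exists_least_iff)

lemma first_rejects_unique: "first_rejects i b s \<Longrightarrow> first_rejects i b s' \<Longrightarrow> s = s'"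
  unfolding first_rejects_def by (meson linorder_neqE_nat)

lemma even_graph_stable:
  "\<exists>s0. \<forall>s\<ge>s0. \<forall>p<n. p \<in> even_approx i s \<longleftrightarrow> p \<in> even_graph i"
proof -
  have "finite (even_graph i \<inter> {..<n})" by simp
  then obtain s0 where s0: "even_graph i \<inter> {..<n} \<subseteq> even_approx i s0"
    using finite_subset_even_graph by blast
  have "p \<in> even_approx i s \<longleftrightarrow> p \<in> even_graph i" if "s0 \<le> s" "p < n" for s p
    using s0 that even_approx_mono[OF that(1)] even_approx_subset_graph by blast
  then show ?thesis by blast
qed

lemma finite_below:
  assumes "single_valued_code X"
  shows "finite {p\<in>X. pfst p < b}"
proof -
  have "inj_on pfst {p\<in>X. pfst p < b}"
    using assms unfolding single_valued_code_def by (auto intro: inj_onI)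
  moreover have "pfst ` {p\<in>X. pfst p < b} \<subseteq> {..<b}" by auto
  ultimately show ?thesis by (meson finite_lessThan finite_imageD finite_subset)
qed

text \<open>Here arguments rather than codes are bounded. Single-valuedness leaves only finitely
  many such points, so all of them have appeared at some stage.\<close>

lemma below_stable: "\<exists>s0. \<forall>s\<ge>s0. {p \<in> even_approx i s. pfst p < b} = {p \<in> even_graph i. pfst p < b}"
proof -
  obtain s0 where s0: "{p \<in> even_graph i. pfst p < b} \<subseteq> even_approx i s0"
    using finite_subset_even_graph[OF finite_below[OF single_valued_even_graph]] by blast
  have "{p \<in> even_approx i s. pfst p < b} = {p \<in> even_graph i. pfst p < b}" if "s0 \<le> s" for s
    using s0 even_approx_mono[OF that] even_approx_subset_graph by blast
  then show ?thesis by blast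
qed

lemma rejected_if_not_needed:
  assumes "\<not> needed i"
  shows "rejected i b"
proof -
  obtain s0 where s0: "\<And>s. s0 \<le> s \<Longrightarrow>
      {p \<in> even_approx i s. pfst p < b} = {p \<in> even_graph i. pfst p < b}"
    using below_stable by blast
  from assms consider j where "j < i" "even_graph j = even_graph i"
    | c where "\<And>x. pair x c \<in> even_graph i"
    unfolding needed_def constant_graph_def by blast
  then show ?thesis
  proof cases
    case 1
    obtain s1 where s1: "\<And>s. s1 \<le> s \<Longrightarrow>
        {p \<in> even_approx j s. pfst p < b} = {p \<in> even_graph j. pfst p < b}"
      using below_stable by blast
    define s where "s = max b (max s0 s1)"
    have "{p \<in> even_approx i s. pfst p < b} = {p \<in> even_approx j s. pfst p < b}"
      using s0[of s] s1[of s] 1(2) by (simp add: s_def)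
    then have "agree j i b s" unfolding agree_def by blast
    then have "rejects i b s" using 1(1) unfolding rejects_def s_def by auto
    then show ?thesis unfolding rejected_def by blast
  next
    case 2
    define s where "s = max (max b c) s0"
    have "pair x c \<in> even_approx i s" if "x < b" for x
    proof -
      have "pair x c \<in> {p \<in> even_graph i. pfst p < b}" using 2 that by simp
      also have "\<dots> = {p \<in> even_approx i s. pfst p < b}" using s0[of s] by (simp add: s_def)
      finally show ?thesis by simp
    qed
    moreover have "b \<le> s" "c \<le> s" unfolding s_def by auto
    ultimately have "rejects i b s" unfolding rejects_def by blast
    then show ?thesis unfolding rejected_def by blast
  qed
qed

text \<open>The reason why \<open>rejects\<close> demands \<open>b \<le> s\<close>: a large bound
  covers a point of the symmetric difference and is examined only at stages where the status of this
  point has settled.\<close>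

lemma eventually_distinguished:
  assumes "even_graph j \<noteq> even_graph i"
  shows "\<exists>b0. \<forall>b\<ge>b0. \<forall>s\<ge>b.
    \<not> agree j i b s"
proof -
  obtain p where p: "p \<in> even_graph j \<longleftrightarrow> p \<notin> even_graph i" using assms by blast
  obtain s0 where s0: "\<And>s. s0 \<le> s \<Longrightarrow> p \<in> even_approx i s \<longleftrightarrow> p \<in> even_graph i"
    using even_graph_stable[of "Suc p"] by blast
  obtain s1 where s1: "\<And>s. s1 \<le> s \<Longrightarrow> p \<in> even_approx j s \<longleftrightarrow> p \<in> even_graph j"
    using even_graph_stable[of "Suc p"] by blast
  show ?thesis
  proof (intro exI[of _ "max (Suc p) (max s0 s1)"] allI impI notI)
    fix b s
    assume b: "max (Suc p) (max s0 s1) \<le> b" "b \<le> s"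
      and eq: "agree j i b s"
    have "p < s" "pfst p < b" "s0 \<le> s" "s1 \<le> s" using b pfst_le[of p] by auto
    then show False using eq p s0 s1 unfolding agree_def by blast
  qed
qed

lemma not_rejected_if_needed:
  assumes "needed i"
  shows "\<exists>b. \<not> rejected i b"
proof -
  have "\<forall>j\<in>{..<i}. \<exists>b0. \<forall>b\<ge>b0. \<forall>s\<ge>b.
      \<not> agree j i b s"
    using assms unfolding needed_def by (intro ballI eventually_distinguished) auto
  from bchoice[OF this] obtain f where f: "\<And>j b s. j < i \<Longrightarrow> f j \<le> b \<Longrightarrow> b \<le> s \<Longrightarrow>
      \<not> agree j i b s"
    by (meson lessThan_iff)
  have "\<not> constant_graph (even_graph i)" using assms unfolding needed_def by blast
  then obtain g where g: "\<And>c. pair (g c) c \<notin> even_graph i"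
    unfolding constant_graph_def by metis
  \<comment> \<open>Only the value at \<open>0\<close> can be the constant.\<close>
  obtain m where m: "\<And>c. pair 0 c \<in> even_graph i \<Longrightarrow> g c < m"
  proof (cases "\<exists>c. pair 0 c \<in> even_graph i")
    case True
    then obtain c where c: "pair 0 c \<in> even_graph i" by blast
    have "d = c" if "pair 0 d \<in> even_graph i" for d
      using single_valued_even_graph[of i] that c unfolding single_valued_code_def by fastforce
    then show ?thesis using that[of "Suc (g c)"] by blast
  qed blast
  \<comment> \<open>Beyond all thresholds \<open>f j\<close> for earlier graphs, and beyond
    \<open>m\<close>, so that the deviation from the only candidate constant is visible. Being
    positive, \<open>b\<close> also forces argument \<open>0\<close> to be examined.\<close>
  define b where "b = Max (insert (Suc m) (f ` {..<i}))"
  have fb: "f j \<le> b" if "j < i" for j using that unfolding b_def by (intro Max_ge) auto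
  have "Suc m \<le> b" unfolding b_def by (rule Max_ge) auto
  then have mb: "m < b" by simp
  have "\<not> rejects i b s" for s
  proof
    assume "rejects i b s"
    then obtain c where c: "\<And>x. x < b \<Longrightarrow> pair x c \<in> even_approx i s"
      unfolding rejects_def using f fb by blast
    have "pair 0 c \<in> even_graph i" using c[of 0] mb even_approx_subset_graph by auto
    then have "g c < b" using m mb order_less_trans by blast
    then show False using c g even_approx_subset_graph by blast
  qed
  then show ?thesis unfolding rejected_def by blast
qed

lemma needed_iff: "needed i \<longleftrightarrow> (\<exists>b. \<not> rejected i b)"
  using rejected_if_not_needed not_rejected_if_needed by blast

subsection \<open>Followers and fillers\<close>

text \<open>A follower \<open>e\<close> codes a triple \<open>(i, b, t)\<close> such that the bound \<open>b\<close> is rejected for \<open>i\<close>, first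
  at stage \<open>t\<close>. It copies the \<open>i\<close>-th graph until the bound \<open>b + 1\<close> is rejected, say first at stage
  \<open>u\<close>. Then it receives the point \<open>(v, 0)\<close> where \<open>v\<close> codes \<open>(e, u)\<close>, and is left alone from then on.
  This point makes the cardinality odd, and \<open>e\<close> can be read off from it since it is the largest
  element.\<close>

definition follower :: "nat \<Rightarrow> bool" where
  "follower e \<longleftrightarrow> first_rejects (pfst e) (pfst (psnd e)) (psnd (psnd e))"

definition follower_graph :: "nat \<Rightarrow> nat set" where
  "follower_graph e = {p. \<exists>s. (\<forall>u<s. \<not> rejects (pfst e) (Suc (pfst (psnd e))) u) \<and>
     (p \<in> even_approx (pfst e) s \<or>
      rejects (pfst e) (Suc (pfst (psnd e))) s \<and> p = pair (pair e s) 0)}"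

definition released :: "nat \<Rightarrow> bool" where
  "released v \<longleftrightarrow> follower (pfst v) \<and>
     first_rejects (pfst (pfst v)) (Suc (pfst (psnd (pfst v)))) (psnd v)"

definition released_graph :: "nat \<Rightarrow> nat set" where
  "released_graph v = insert (pair v 0) (even_approx (pfst (pfst v)) (psnd v))"

definition filler :: "nat \<Rightarrow> bool" where
  "filler n \<longleftrightarrow> odd (card (set_decode n)) \<and> single_valued_code (set_decode n) \<and>
     \<not> (\<exists>v. released v \<and> set_decode n = released_graph v)"

lemma follower_graph_permanent:
  assumes "\<not> rejected (pfst e) (Suc (pfst (psnd e)))"
  shows "follower_graph e = even_graph (pfst e)"
  using assms unfolding follower_graph_def rejected_def even_graph_def by auto

lemma follower_graph_released:
  assumes "released v"
  shows "follower_graph (pfst v) = released_graph v"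
proof -
  let ?R = "rejects (pfst (pfst v)) (Suc (pfst (psnd (pfst v))))"
  have u: "?R (psnd v)" "\<forall>u<psnd v. \<not> ?R u"
    using assms unfolding released_def first_rejects_def by auto
  \<comment> \<open>Stages without an earlier rejection are those up to \<open>psnd v\<close>
    inclusive: the approximation at the rejection stage itself is still copied.\<close>
  have le: "s \<le> psnd v" if "\<forall>u<s. \<not> ?R u" for s
    using u that by (meson not_le)
  have eq: "s = psnd v" if "\<forall>u<s. \<not> ?R u" "?R s" for s
    using le[OF that(1)] u that by (meson le_neq_implies_less)
  have v: "pair (pair (pfst v) (psnd v)) 0 = pair v 0" by simp
  show ?thesis
  proof (intro set_eqI iffI)
    fix p assume "p \<in> follower_graph (pfst v)"
    then show "p \<in> released_graph v"
      using even_approx_mono[OF le] eq v unfolding follower_graph_def released_graph_def by blast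
  next
    fix p assume "p \<in> released_graph v"
    then show "p \<in> follower_graph (pfst v)"
      unfolding follower_graph_def mem_Collect_eq
      by (intro exI[of _ "psnd v"]) (use u v in \<open>auto simp: released_graph_def\<close>)
  qed
qed

text \<open>All copied points, and hence their arguments, lie below \<open>v\<close>. Therefore
  \<open>pair v 0\<close> is new, preserves single-valuedness and is the maximum.\<close>

lemma even_approx_less_released:
  assumes "p \<in> even_approx i (psnd v)"
  shows "p < v"
  using even_approx_bound[OF assms] psnd_le[of v] by simp

lemma released_point_notin: "pair v 0 \<notin> even_approx i (psnd v)"
  using even_approx_less_released[of "pair v 0" i v] le_prod_encode_1[of v 0] by force

lemma finite_released_graph: "finite (released_graph v)"
  unfolding released_graph_def by (simp add: finite_even_approx)

lemma odd_card_released_graph: "odd (card (released_graph v))"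
  unfolding released_graph_def
  by (simp add: finite_even_approx released_point_notin even_card_even_approx)

lemma single_valued_released_graph: "single_valued_code (released_graph v)"
proof -
  have "pfst p \<noteq> v" if "p \<in> even_approx i (psnd v)" for p i
    using even_approx_less_released[OF that] pfst_le[of p] by simp
  moreover have "single_valued_code (even_approx i s)" for i s
    using single_valued_code_subset[OF single_valued_even_graph even_approx_subset_graph] .
  ultimately show ?thesis
    unfolding released_graph_def single_valued_code_def by (metis insert_iff pfst_pair)
qed

lemma Max_released_graph: "Max (released_graph v) = pair v 0"
proof (rule Max_eqI)
  show "p \<le> pair v 0" if "p \<in> released_graph v" for p
    using that even_approx_less_released[of p] le_prod_encode_1[of v 0]
    unfolding released_graph_def by (auto dest: order_less_le_trans intro: less_imp_le)
qed (auto simp: finite_released_graph, simp add: released_graph_def)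

lemma inj_released_graph: "released_graph v = released_graph v' \<Longrightarrow> v = v'"
  using Max_released_graph by (metis pfst_pair)

section \<open>The indexed family: no repetitions, nothing missing\<close>

definition valid_index :: "nat \<Rightarrow> bool" where
  "valid_index z \<longleftrightarrow> pfst z = 0 \<or> pfst z = 1 \<and> follower (psnd z) \<or> pfst z = 2 \<and> filler (psnd z)"

definition indexed_graph :: "nat \<Rightarrow> nat set" where
  "indexed_graph z =
    (if pfst z = 0 then {p. psnd p = psnd z}
     else if pfst z = 1 then follower_graph (psnd z)
     else set_decode (psnd z))"

lemma follower_cases:
  assumes "follower e"
  obtains (permanent) "\<not> rejected (pfst e) (Suc (pfst (psnd e)))"
      "follower_graph e = even_graph (pfst e)" "needed (pfst e)"
  | (released) v where "released v" "e = pfst v" "follower_graph e = released_graph v"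
proof (cases "rejected (pfst e) (Suc (pfst (psnd e)))")
  case True
  then obtain u where "first_rejects (pfst e) (Suc (pfst (psnd e))) u"
    unfolding rejected_iff_first by blast
  then have "released (pair e u)" using assms by (simp add: released_def)
  with follower_graph_released[OF this] show ?thesis by (intro released[of "pair e u"]) auto
next
  case False
  then show ?thesis using follower_graph_permanent needed_iff by (intro permanent) blast+
qed

lemma single_valued_indexed_graph:
  assumes "valid_index z"
  shows "single_valued_code (indexed_graph z)"
proof -
  from assms consider "pfst z = 0" | "pfst z = 1" "follower (psnd z)" | "pfst z = 2" "filler (psnd z)"
    unfolding valid_index_def by auto
  then show ?thesis
  proof cases
    case 1
    then show ?thesis
      unfolding indexed_graph_def single_valued_code_def by (metis mem_Collect_eq pair_pfst_psnd)
  next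
    case 2
    from 2(2) show ?thesis
      by (rule follower_cases)
        (use 2(1) in \<open>auto simp: indexed_graph_def single_valued_even_graph single_valued_released_graph\<close>)
  next
    case 3
    then show ?thesis by (simp add: indexed_graph_def filler_def)
  qed
qed

lemma constant_graph_infinite:
  assumes "constant_graph X"
  shows "infinite X"
proof -
  obtain c where c: "\<And>x. pair x c \<in> X" using assms unfolding constant_graph_def by blast
  have "inj (\<lambda>x. pair x c)" by (rule injI) simp
  then have "infinite (range (\<lambda>x. pair x c))" using finite_imageD by blast
  moreover have "range (\<lambda>x. pair x c) \<subseteq> X" using c by blast
  ultimately show ?thesis using finite_subset by blast
qed

text \<open>The bound must be the last rejected one, and the stage is determined as the first at
  which that bound is rejected.\<close>

lemma permanent_follower_unique:
  assumes "follower e" "\<not> rejected (pfst e) (Suc (pfst (psnd e)))"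
    and "follower e'" "\<not> rejected (pfst e') (Suc (pfst (psnd e')))"
    and "pfst e = pfst e'"
  shows "e = e'"
proof -
  let ?b = "pfst (psnd e)" and ?b' = "pfst (psnd e')"
  have "rejected (pfst e) ?b" "rejected (pfst e) ?b'"
    using assms unfolding follower_def rejected_iff_first by auto
  then have "\<not> Suc ?b' \<le> ?b" "\<not> Suc ?b \<le> ?b'"
    using assms rejects_antimono unfolding rejected_def by metis+
  then have b: "?b = ?b'" by simp
  then have "psnd (psnd e) = psnd (psnd e')"
    using assms first_rejects_unique unfolding follower_def by metis
  with b assms(5) show ?thesis by (metis pair_pfst_psnd)
qed

lemma indexed_graph_cases:
  assumes "valid_index z"
  obtains (const) "pfst z = 0" "indexed_graph z = {p. psnd p = psnd z}"
      "constant_graph (indexed_graph z)"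
  | (permanent) "pfst z = 1" "follower (psnd z)"
      "\<not> rejected (pfst (psnd z)) (Suc (pfst (psnd (psnd z))))"
      "indexed_graph z = even_graph (pfst (psnd z))" "needed (pfst (psnd z))"
  | (released) v where "pfst z = 1" "released v" "psnd z = pfst v" "indexed_graph z = released_graph v"
  | (filler) "pfst z = 2" "filler (psnd z)" "indexed_graph z = set_decode (psnd z)"
proof -
  from assms consider "pfst z = 0" | "pfst z = 1" "follower (psnd z)" | "pfst z = 2" "filler (psnd z)"
    unfolding valid_index_def by auto
  then show ?thesis
  proof cases
    case 1
    then show ?thesis by (intro const) (auto simp: indexed_graph_def constant_graph_def)
  next
    case 2
    from 2(2) show ?thesis
      by (rule follower_cases) (use 2 permanent released in \<open>auto simp: indexed_graph_def\<close>)
  next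
    case 3
    then show ?thesis by (intro filler) (auto simp: indexed_graph_def)
  qed
qed

text \<open>Released graphs and fillers are finite, and a permanent follower copies the graph of a
  needed index, which is not constant.\<close>

lemma constant_indexed_graph_iff:
  assumes "valid_index z"
  shows "constant_graph (indexed_graph z) \<longleftrightarrow> pfst z = 0"
  using assms
proof (cases rule: indexed_graph_cases)
  case (released v)
  then show ?thesis using constant_graph_infinite finite_released_graph by force
next
  case filler
  then show ?thesis using constant_graph_infinite finite_set_decode by force
qed (auto simp: needed_def)

text \<open>Parity separates the permanent followers from released followers and fillers, so that
  coincidences remain to be excluded only within these two groups.\<close>

lemma odd_indexed_graph_iff:
  assumes "valid_index z" "pfst z \<noteq> 0"
  shows "finite (indexed_graph z) \<and> odd (card (indexed_graph z)) \<longleftrightarrow>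
    \<not> (pfst z = 1 \<and> \<not> rejected (pfst (psnd z)) (Suc (pfst (psnd (psnd z)))))"
  using assms(1)
proof (cases rule: indexed_graph_cases)
  case permanent
  then show ?thesis using infinite_or_even_even_graph by auto
next
  case (released v)
  then have "rejected (pfst (psnd z)) (Suc (pfst (psnd (psnd z))))"
    unfolding released_def rejected_iff_first by auto
  then show ?thesis using released finite_released_graph odd_card_released_graph by auto
next
  case filler
  then show ?thesis by (simp add: filler_def)
qed (use assms in simp)

lemma inj_indexed_graph:
  assumes z: "valid_index z" and z': "valid_index z'" and eq: "indexed_graph z = indexed_graph z'"
  shows "z = z'"
proof -
  have eq0: "pfst z = 0 \<longleftrightarrow> pfst z' = 0"
    using constant_indexed_graph_iff[OF z] constant_indexed_graph_iff[OF z'] eq by simp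
  have "pfst z = pfst z' \<and> psnd z = psnd z'"
    using z
  proof (cases rule: indexed_graph_cases)
    case const
    then have "pair 0 (psnd z) \<in> indexed_graph z'" using eq by auto
    then show ?thesis using const eq0 by (simp add: indexed_graph_def)
  next
    case permanent
    then have "pfst z' = 1" "\<not> rejected (pfst (psnd z')) (Suc (pfst (psnd (psnd z'))))"
      using eq0 odd_indexed_graph_iff[OF z] odd_indexed_graph_iff[OF z'] eq by auto
    then have z'': "follower (psnd z')" "indexed_graph z' = even_graph (pfst (psnd z'))"
        "needed (pfst (psnd z'))"
      using z' follower_graph_permanent needed_iff unfolding valid_index_def indexed_graph_def by auto
    \<comment> \<open>Both indices are needed and have the same graph, so neither can be the smaller
      one.\<close>
    have "pfst (psnd z) = pfst (psnd z')"
      using permanent z'' eq unfolding needed_def by (metis linorder_neqE_nat)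
    then show ?thesis
      using permanent_follower_unique \<open>pfst z' = 1\<close> permanent z''
        \<open>\<not> rejected (pfst (psnd z')) (Suc (pfst (psnd (psnd z'))))\<close> by metis
  next
    case (released v)
    then have fin: "finite (indexed_graph z') \<and> odd (card (indexed_graph z'))"
      using eq finite_released_graph odd_card_released_graph by auto
    from z' show ?thesis
    proof (cases rule: indexed_graph_cases)
      case (released v')
      then show ?thesis using \<open>pfst z = 1\<close> \<open>psnd z = pfst v\<close> \<open>indexed_graph z = released_graph v\<close> eq
          inj_released_graph by metis
    next
      case filler
      then show ?thesis using eq \<open>released v\<close> \<open>indexed_graph z = released_graph v\<close>
        unfolding filler_def by metis
    next
      case permanent
      then show ?thesis using fin infinite_or_even_even_graph by auto
    qed (use eq0 released in simp)
  next
    case filler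
    then have fin: "finite (indexed_graph z') \<and> odd (card (indexed_graph z'))"
      using eq by (metis filler_def finite_set_decode)
    from z' show ?thesis
    proof (cases rule: indexed_graph_cases)
      case (released v')
      then show ?thesis using eq filler unfolding filler_def by metis
    next
      case f: filler
      then show ?thesis using eq filler by (metis set_decode_inverse)
    next
      case permanent
      then show ?thesis using fin infinite_or_even_even_graph by auto
    qed (use eq0 filler in simp)
  qed
  then show ?thesis by (metis pair_pfst_psnd)
qed

lemma indexed_graph_complete: "\<exists>z. valid_index z \<and> indexed_graph z = (\<Union>s. approx i s)"
proof -
  let ?X = "\<Union>s. approx i s"
  consider "constant_graph ?X" | "finite ?X" "odd (card ?X)"
    | "\<not> constant_graph ?X" "infinite ?X \<or> even (card ?X)" by blast
  then show ?thesis
  proof cases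
    case 1
    then obtain c where c: "\<And>x. pair x c \<in> ?X" unfolding constant_graph_def by blast
    have "p \<in> ?X \<longleftrightarrow> psnd p = c" for p
    proof
      assume "p \<in> ?X"
      then have "p = pair (pfst p) c"
        using single_valued_Union_approx c[of "pfst p"] unfolding single_valued_code_def by (metis pfst_pair)
      then show "psnd p = c" by (metis psnd_pair)
    next
      assume "psnd p = c"
      then show "p \<in> ?X" using c[of "pfst p"] by (metis pair_pfst_psnd)
    qed
    then have "indexed_graph (pair 0 c) = ?X" unfolding indexed_graph_def by auto
    moreover have "valid_index (pair 0 c)" by (simp add: valid_index_def)
    ultimately show ?thesis by blast
  next
    case 2
    show ?thesis
    proof (cases "\<exists>v. released v \<and> ?X = released_graph v")
      case True
      then obtain v where v: "released v" "?X = released_graph v" by blast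
      then have "valid_index (pair 1 (pfst v))" "indexed_graph (pair 1 (pfst v)) = ?X"
        using follower_graph_released by (auto simp: valid_index_def indexed_graph_def released_def)
      then show ?thesis by blast
    next
      case False
      then have "filler (set_encode ?X)"
        using 2 single_valued_Union_approx by (simp add: filler_def)
      then have "valid_index (pair 2 (set_encode ?X))" "indexed_graph (pair 2 (set_encode ?X)) = ?X"
        using 2 by (simp_all add: valid_index_def indexed_graph_def)
      then show ?thesis by blast
    qed
  next
    case 3
    have "even_graph i = ?X" by (rule even_graph_eq[OF 3(2)])
    then have ex: "\<exists>j. even_graph j = ?X" by blast
    define j where "j = (LEAST j. even_graph j = ?X)"
    have j: "even_graph j = ?X" unfolding j_def using ex by (rule LeastI_ex)
    have "even_graph k \<noteq> ?X" if "k < j" for k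
      using not_less_Least[of k "\<lambda>j. even_graph j = ?X"] that unfolding j_def by blast
    then have "needed j" using j 3(1) by (auto simp: needed_def)
    \<comment> \<open>The bound \<open>0\<close> is rejected and some bound is not, so rejection
      stops between some \<open>b\<close> and \<open>Suc b\<close>.\<close>
    then obtain b where b: "\<not> rejected j (Suc b)" "rejected j b"
      unfolding needed_iff using rejected_0[of j]
      by (metis not0_implies_Suc nat_induct)
    obtain t where t: "first_rejects j b t" using b(2) unfolding rejected_iff_first by blast
    let ?z = "pair 1 (pair j (pair b t))"
    have "valid_index ?z" using t by (simp add: valid_index_def follower_def)
    moreover have "indexed_graph ?z = ?X"
      using follower_graph_permanent[of "pair j (pair b t)"] b(1) j by (simp add: indexed_graph_def)
    ultimately show ?thesis by blast
  qed
qed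

subsection \<open>Computability of the enumeration\<close>

lemma decidable_rejects [computable_intros]:
  assumes "computable f" "computable g" "computable h"
  shows "decidable (\<lambda>z. rejects (f z) (g z) (h z))"
proof -
  have "decidable (\<lambda>w. rejects (pfst w) (pfst (psnd w)) (psnd (psnd w)))"
    unfolding rejects_def agree_def by (intro computable_intros)
  from decidable_comp[OF this, of "\<lambda>z. pair (f z) (pair (g z) (h z))"] show ?thesis
    by (simp add: assms computable_intros)
qed

lemma decidable_first_rejects [computable_intros]:
  assumes "computable f" "computable g" "computable h"
  shows "decidable (\<lambda>z. first_rejects (f z) (g z) (h z))"
proof -
  have "decidable (\<lambda>w. first_rejects (pfst w) (pfst (psnd w)) (psnd (psnd w)))"
    unfolding first_rejects_def by (intro computable_intros)
  from decidable_comp[OF this, of "\<lambda>z. pair (f z) (pair (g z) (h z))"] show ?thesis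
    by (simp add: assms computable_intros)
qed

lemma set_decode_less: "k \<in> set_decode n \<Longrightarrow> k < n"
proof -
  assume "k \<in> set_decode n"
  then have "n div 2 ^ k \<noteq> 0" by (auto simp: set_decode_def intro: ccontr)
  then have "2 ^ k \<le> n" by (auto simp: div_eq_0_iff)
  then show ?thesis using less_exp[of k] by (rule order_less_le_trans[rotated])
qed

text \<open>Form with bounded quantifiers: members of a coded set are smaller than its code, and a
  released graph contains \<open>pair v 0\<close>, which bounds \<open>v\<close> as well.\<close>

lemma filler_iff:
  "filler n \<longleftrightarrow> odd (card {k. k < n \<and> k \<in> set_decode n}) \<and>
     (\<forall>p<n. \<forall>q<n. p \<in> set_decode n \<and> q \<in> set_decode n \<and> pfst p = pfst q \<longrightarrow> p = q) \<and>
     \<not> (\<exists>v<n. released v \<and> pair v 0 \<in> set_decode n \<and>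
          (\<forall>k<n. k \<in> set_decode n \<longleftrightarrow> k = pair v 0 \<or> k \<in> even_approx (pfst (pfst v)) (psnd v)))"
proof -
  have "{k. k < n \<and> k \<in> set_decode n} = set_decode n" by (auto dest: set_decode_less)
  moreover have "single_valued_code (set_decode n) \<longleftrightarrow>
      (\<forall>p<n. \<forall>q<n. p \<in> set_decode n \<and> q \<in> set_decode n \<and> pfst p = pfst q \<longrightarrow> p = q)"
    unfolding single_valued_code_def by (auto dest: set_decode_less)
  moreover have "set_decode n = released_graph v \<longleftrightarrow> v < n \<and> pair v 0 \<in> set_decode n \<and>
      (\<forall>k<n. k \<in> set_decode n \<longleftrightarrow> k = pair v 0 \<or> k \<in> even_approx (pfst (pfst v)) (psnd v))" for v
  proof
    assume eq: "set_decode n = released_graph v"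
    then have "pair v 0 \<in> set_decode n" by (simp add: released_graph_def)
    moreover from set_decode_less[OF this] have "v < n"
      using le_prod_encode_1[of v 0] by simp
    ultimately show "v < n \<and> pair v 0 \<in> set_decode n \<and>
        (\<forall>k<n. k \<in> set_decode n \<longleftrightarrow> k = pair v 0 \<or> k \<in> even_approx (pfst (pfst v)) (psnd v))"
      using eq by (simp add: released_graph_def)
  next
    assume *: "v < n \<and> pair v 0 \<in> set_decode n \<and>
        (\<forall>k<n. k \<in> set_decode n \<longleftrightarrow> k = pair v 0 \<or> k \<in> even_approx (pfst (pfst v)) (psnd v))"
    have "k < n" if "k \<in> released_graph v" for k
      using that * even_approx_less_released set_decode_less
      unfolding released_graph_def by (metis insert_iff order_less_trans)
    with * show "set_decode n = released_graph v"
      unfolding released_graph_def by (auto dest: set_decode_less)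
  qed
  ultimately show ?thesis unfolding filler_def by auto
qed

text \<open>Being a follower is decidable because the code names the stage of first rejection
  instead of merely asserting that one exists.\<close>

lemma decidable_valid_index: "decidable valid_index"
  unfolding valid_index_def[abs_def] filler_iff released_def follower_def
  by (intro computable_intros)

lemma semidecidable_indexed_graph:
  "\<exists>R. decidable R \<and> (\<forall>z p. p \<in> indexed_graph z \<longleftrightarrow> (\<exists>s. R (pair z (pair p s))))"
proof -
  define R where "R w \<longleftrightarrow>
    pfst (pfst w) = 0 \<and> psnd (pfst (psnd w)) = psnd (pfst w) \<or>
    pfst (pfst w) = 1 \<and>
      (\<forall>u<psnd (psnd w). \<not> rejects (pfst (psnd (pfst w))) (Suc (pfst (psnd (psnd (pfst w))))) u) \<and>
      (pfst (psnd w) \<in> even_approx (pfst (psnd (pfst w))) (psnd (psnd w)) \<or>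
        rejects (pfst (psnd (pfst w))) (Suc (pfst (psnd (psnd (pfst w))))) (psnd (psnd w)) \<and>
        pfst (psnd w) = pair (pair (psnd (pfst w)) (psnd (psnd w))) 0) \<or>
    1 < pfst (pfst w) \<and> pfst (psnd w) \<in> set_decode (psnd (pfst w))" for w
  have "decidable R" unfolding R_def[abs_def] by (intro computable_intros)
  moreover have "p \<in> indexed_graph z \<longleftrightarrow> (\<exists>s. R (pair z (pair p s)))" for z p
    unfolding R_def indexed_graph_def follower_graph_def by auto
  ultimately show ?thesis by blast
qed

section \<open>The partial applicative structure\<close>

text \<open>Minimisation runs over codes of a value together with a witness, and the value is
  returned. As \<open>psi\<close> is a function, the least code yields the same value as any
  other.\<close>

lemma partial_computable2_if_semidecidable:
  assumes "decidable R" and psi: "\<And>x m y. psi x m = Some y \<longleftrightarrow> (\<exists>s. R (pair x (pair m (pair y s))))"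
  shows "partial_computable2 psi"
proof -
  have "computable (\<lambda>w. of_bool (\<not> R w))" by (intro computable_intros assms(1))
  \<comment> \<open>\<open>Mn\<close> puts the search variable in front of the arguments and stops
    at value \<open>0\<close>; hence the permuted arguments and the negation.\<close>
  then have "list_computable (Suc (Suc (Suc 0)))
      (\<lambda>xs. of_bool (\<not> R (pair (xs ! Suc 0) (pair (xs ! Suc (Suc 0)) (xs ! 0)))))"
    by (rule list_computable_comp1) (auto intro!: list_computable_intros)
  then obtain t where "\<And>xs. length xs = Suc (Suc (Suc 0)) \<Longrightarrow>
      eval t xs (of_bool (\<not> R (pair (xs ! Suc 0) (pair (xs ! Suc (Suc 0)) (xs ! 0)))))"
    unfolding list_computable_def by blast
  from this[of "[_, _, _]"]
  have t: "eval t [w, x, m] (of_bool (\<not> R (pair x (pair m w))))" for w x m by simp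
  obtain u where u: "\<And>x. eval u [x] (pfst x)"
    using computable_pfst unfolding computable_def by blast
  have R: "psi x m = Some (pfst w)" if "R (pair x (pair m w))" for x m w
    using psi[of x m "pfst w"] that by (metis pair_pfst_psnd)
  have "psi x m = Some y \<longleftrightarrow> eval (Cn u [Mn t]) [x, m] y" for x m y
  proof
    assume y: "psi x m = Some y"
    then have "\<exists>w. R (pair x (pair m w))" unfolding psi by blast
    from exists_least_iff[THEN iffD1, OF this]
    obtain w where w: "R (pair x (pair m w))" "\<forall>v<w. \<not> R (pair x (pair m v))" by blast
    have "eval (Mn t) [x, m] w"
    proof (rule eval_Mn)
      show "eval t [w, x, m] 0" using t[of w x m] w(1) by simp
      show "\<forall>v<w. \<exists>z. z \<noteq> 0 \<and> eval t [v, x, m] z"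
      proof (intro allI impI)
        fix v assume "v < w"
        then have "eval t [v, x, m] 1" using t[of v x m] w(2) by simp
        then show "\<exists>z. z \<noteq> 0 \<and> eval t [v, x, m] z" using one_neq_zero by blast
      qed
    qed
    moreover have "y = pfst w" using R[OF w(1)] y by simp
    ultimately show "eval (Cn u [Mn t]) [x, m] y" using u by (intro eval_Cn[of _ _ "[w]"]) auto
  next
    assume "eval (Cn u [Mn t]) [x, m] y"
    then obtain ws where ws: "list_all2 (\<lambda>g. eval g [x, m]) [Mn t] ws" "eval u ws y"
      by (rule eval_CnE)
    then obtain w where w: "ws = [w]" "eval (Mn t) [x, m] w" by (auto simp: list_all2_Cons1)
    from w(2) have "eval t [w, x, m] 0" by (auto elim: eval_MnE)
    with t have "0 = (of_bool (\<not> R (pair x (pair m w))) :: nat)" by (rule eval_deterministic[rotated])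
    then have "R (pair x (pair m w))" by (auto split: if_splits)
    moreover have "y = pfst w" using eval_deterministic[OF u] ws(2) w(1) by simp
    ultimately show "psi x m = Some y" using R by simp
  qed
  then show ?thesis unfolding partial_computable2_def by blast
qed

lemma partial_computable1_section:
  assumes "partial_computable2 psi"
  shows "partial_computable1 (psi x)"
proof -
  obtain t where t: "\<And>x m y. psi x m = Some y \<longleftrightarrow> eval t [x, m] y"
    using assms unfolding partial_computable2_def by blast
  obtain c where c: "\<And>m. eval c [m] x"
    using computable_const[of x] unfolding computable_def by blast
  have id: "eval (Id 0) [m] m" for m using eval_Id[of 0 "[m]"] by simp
  have "psi x m = Some y \<longleftrightarrow> eval (Cn t [c, Id 0]) [m] y" for m y
  proof
    assume "psi x m = Some y"
    then show "eval (Cn t [c, Id 0]) [m] y"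
      using t c id by (intro eval_Cn[of _ _ "[x, m]"]) auto
  next
    assume "eval (Cn t [c, Id 0]) [m] y"
    then obtain ws where ws: "list_all2 (\<lambda>g. eval g [m]) [c, Id 0] ws" "eval t ws y"
      by (rule eval_CnE)
    then have "ws = [x, m]"
      using eval_deterministic[OF c] eval_deterministic[OF id] by (auto simp: list_all2_Cons1)
    then show "psi x m = Some y" using t ws(2) by simp
  qed
  then show ?thesis unfolding partial_computable1_def by blast
qed

lemma partial_computable1_Some:
  assumes "computable f"
  shows "partial_computable1 (\<lambda>x. Some (f x))"
proof -
  obtain t where "\<And>x. eval t [x] (f x)" using assms unfolding computable_def by blast
  then have "Some (f x) = Some y \<longleftrightarrow> eval t [x] y" for x y
    using eval_deterministic[of t "[x]" "f x" y] by auto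
  then show ?thesis unfolding partial_computable1_def by blast
qed

section \<open>Partial functions and their graphs\<close>

definition graph :: "(nat \<Rightarrow> nat option) \<Rightarrow> nat set" where
  "graph f = {p. f (pfst p) = Some (psnd p)}"

lemma graph_inject: "graph f = graph g \<Longrightarrow> f = g"
proof
  fix x assume "graph f = graph g"
  then have "f x = Some y \<longleftrightarrow> g x = Some y" for y
    unfolding graph_def set_eq_iff mem_Collect_eq by (metis pfst_pair psnd_pair)
  then show "f x = g x" by (metis option.exhaust)
qed

lemma graph_partial_computable1:
  assumes "partial_computable1 f"
  shows "\<exists>i. graph f = (\<Union>s. approx i s)"
proof -
  obtain t where t: "\<And>x y. f x = Some y \<longleftrightarrow> eval t [x] y"
    using assms unfolding partial_computable1_def by blast
  obtain i where "recf_of i = t" using recf_of_surj by blast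
  then have "graph f = (\<Union>s. approx i s)" unfolding Union_approx graph_def by (simp add: t)
  then show ?thesis by blast
qed

definition function_of :: "nat set \<Rightarrow> nat \<Rightarrow> nat option" where
  "function_of X x = (if \<exists>y. pair x y \<in> X then Some (THE y. pair x y \<in> X) else None)"

lemma function_of_eq_Some:
  assumes "single_valued_code X"
  shows "function_of X x = Some y \<longleftrightarrow> pair x y \<in> X"
proof -
  have "(THE y. pair x y \<in> X) = y" if "pair x y \<in> X" for y
    using that assms unfolding single_valued_code_def by (intro the_equality) fastforce+
  then show ?thesis unfolding function_of_def by auto
qed

lemma graph_function_of: "single_valued_code X \<Longrightarrow> graph (function_of X) = X"
  by (simp add: graph_def function_of_eq_Some)

section \<open>Renumbering the valid indices without gaps\<close>

definition rank :: "nat \<Rightarrow> nat" where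
  "rank z = card {k. k < z \<and> valid_index k}"

lemma rank_less: "valid_index z \<Longrightarrow> z < z' \<Longrightarrow> rank z < rank z'"
  unfolding rank_def by (intro psubset_card_mono) auto

lemma inj_rank: "valid_index z \<Longrightarrow> valid_index z' \<Longrightarrow> rank z = rank z' \<Longrightarrow> z = z'"
  using rank_less by (metis linorder_neqE_nat less_irrefl)

lemma rank_Suc: "rank (Suc z) = rank z + of_bool (valid_index z)"
proof -
  have "{k. k < Suc z \<and> valid_index k} =
      (if valid_index z then insert z {k. k < z \<and> valid_index k} else {k. k < z \<and> valid_index k})"
    by (auto simp: less_Suc_eq)
  then show ?thesis unfolding rank_def by simp
qed

lemma infinite_valid_index: "infinite {z. valid_index z}"
proof -
  have "inj (pair 0)" by (rule injI) simp
  then have "infinite (range (pair 0))" using finite_imageD by blast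
  moreover have "range (pair 0) \<subseteq> {z. valid_index z}" by (auto simp: valid_index_def)
  ultimately show ?thesis using finite_subset by blast
qed

lemma rank_surj: "\<exists>z. valid_index z \<and> rank z = n"
proof -
  obtain F where F: "finite F" "card F = Suc n" "F \<subseteq> {z. valid_index z}"
    using infinite_arbitrarily_large[OF infinite_valid_index] by blast
  have "F \<subseteq> {k. k < Suc (Max F) \<and> valid_index k}" using F Max_ge by (auto simp: less_Suc_eq_le)
  then have "n < rank (Suc (Max F))"
    unfolding rank_def using F(2) card_mono[of "{k. k < Suc (Max F) \<and> valid_index k}" F] by simp
  \<comment> \<open>\<open>rank\<close> starts at \<open>0\<close> and grows by at most one per
    step, so the first \<open>w\<close> with rank above \<open>n\<close> directly follows a valid
    index of rank \<open>n\<close>.\<close>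
  then obtain w where w: "n < rank w" "\<forall>v<w. \<not> n < rank v"
    using exists_least_iff[of "\<lambda>w. n < rank w"] by blast
  then obtain z where z: "w = Suc z" by (cases w) (auto simp: rank_def)
  then have "valid_index z \<and> rank z = n"
    using w rank_Suc[of z] by (auto simp: of_bool_def split: if_splits)
  then show ?thesis by blast
qed

text \<open>The renumbering thus keeps the index \<open>rank (pair 0 a)\<close> of the constant
  function \<open>a\<close> computable from \<open>a\<close>.\<close>

lemma computable_rank: "computable rank"
  unfolding rank_def[abs_def]
  by (intro computable_intros decidable_comp[OF decidable_valid_index])

definition index_of_rank :: "nat \<Rightarrow> nat" where
  "index_of_rank n = (SOME z. valid_index z \<and> rank z = n)"

lemma index_of_rank: "valid_index (index_of_rank n)" "rank (index_of_rank n) = n"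
  using someI_ex[OF rank_surj[of n]] unfolding index_of_rank_def by auto

lemma index_of_rank_rank: "valid_index z \<Longrightarrow> index_of_rank (rank z) = z"
  using inj_rank index_of_rank by blast

definition enumeration :: "nat \<Rightarrow> nat \<Rightarrow> nat option" where
  "enumeration n = function_of (indexed_graph (index_of_rank n))"

lemma enumeration_eq_Some:
  "enumeration n x = Some y \<longleftrightarrow> pair x y \<in> indexed_graph (index_of_rank n)"
  unfolding enumeration_def
  by (intro function_of_eq_Some single_valued_indexed_graph index_of_rank)

lemma graph_enumeration: "graph (enumeration n) = indexed_graph (index_of_rank n)"
  unfolding enumeration_def
  by (intro graph_function_of single_valued_indexed_graph index_of_rank)

lemma inj_enumeration: "enumeration m = enumeration n \<Longrightarrow> m = n"
  using graph_enumeration inj_indexed_graph index_of_rank by metis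

lemma partial_computable2_enumeration: "partial_computable2 enumeration"
proof -
  obtain R where R: "decidable R"
    "\<And>z p. p \<in> indexed_graph z \<longleftrightarrow> (\<exists>s. R (pair z (pair p s)))"
    using semidecidable_indexed_graph by blast
  let ?z = "\<lambda>w. pfst (psnd (psnd (psnd w)))" and ?s = "\<lambda>w. psnd (psnd (psnd (psnd w)))"
  \<comment> \<open>The index of rank \<open>n\<close> is searched for along with the stage;
    injectivity of \<open>rank\<close> on valid indices ensures that the one found is
    \<open>index_of_rank n\<close>.\<close>
  let ?Q = "\<lambda>w. valid_index (?z w) \<and> rank (?z w) = pfst w \<and>
    R (pair (?z w) (pair (pair (pfst (psnd w)) (pfst (psnd (psnd w)))) (?s w)))"
  show ?thesis
  proof (rule partial_computable2_if_semidecidable)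
    show "decidable ?Q"
      by (intro computable_intros decidable_comp[OF decidable_valid_index]
          decidable_comp[OF R(1)] computable_comp[OF computable_rank])
    fix n x y
    have "enumeration n x = Some y \<longleftrightarrow> (\<exists>s. R (pair (index_of_rank n) (pair (pair x y) s)))"
      unfolding enumeration_eq_Some by (rule R(2))
    also have "\<dots> \<longleftrightarrow> (\<exists>s. ?Q (pair n (pair x (pair y s))))"
    proof
      assume "\<exists>s. R (pair (index_of_rank n) (pair (pair x y) s))"
      then obtain s where "R (pair (index_of_rank n) (pair (pair x y) s))" by blast
      then have "?Q (pair n (pair x (pair y (pair (index_of_rank n) s))))"
        by (simp add: index_of_rank)
      then show "\<exists>s. ?Q (pair n (pair x (pair y s)))" by blast
    next
      assume "\<exists>s. ?Q (pair n (pair x (pair y s)))"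
      then show "\<exists>s. R (pair (index_of_rank n) (pair (pair x y) s))"
        by (auto simp: index_of_rank_rank)
    qed
    finally show "enumeration n x = Some y \<longleftrightarrow> (\<exists>s. ?Q (pair n (pair x (pair y s))))" .
  qed
qed

lemma computable_enum_norep_enumeration: "computable_enum_norep enumeration"
  unfolding computable_enum_norep_def
proof (intro conjI allI impI)
  show "partial_computable2 enumeration" by (rule partial_computable2_enumeration)
  then show "partial_computable1 (enumeration x)" for x by (rule partial_computable1_section)
  fix f assume "partial_computable1 f"
  then obtain i where "graph f = (\<Union>s. approx i s)" using graph_partial_computable1 by blast
  then obtain z where z: "valid_index z" "indexed_graph z = graph f"
    using indexed_graph_complete by metis
  then have "enumeration (rank z) = f"
    by (intro graph_inject) (simp add: graph_enumeration index_of_rank_rank)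
  then show "\<exists>!x. enumeration x = f" using inj_enumeration by blast
qed

lemma enumeration_constant: "enumeration (rank (pair 0 a)) b = Some a"
proof -
  have "valid_index (pair 0 a)" by (simp add: valid_index_def)
  then show ?thesis by (simp add: enumeration_eq_Some index_of_rank_rank indexed_graph_def)
qed

theorem mainTheorem8:
  shows "\<exists>psi :: nat \<Rightarrow> nat \<Rightarrow> nat option.
           computable_enum_norep psi \<and> pas_extensional psi \<and>
           (\<exists>k. pas_total psi k \<and> (\<forall>a b. app2 psi k a b = Some a))"
proof -
  have "computable (\<lambda>a. rank (pair 0 a))"
    by (intro computable_comp[OF computable_rank] computable_intros)
  then have "partial_computable1 (\<lambda>a. Some (rank (pair 0 a)))" by (rule partial_computable1_Some)
  then obtain k where k: "enumeration k = (\<lambda>a. Some (rank (pair 0 a)))"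
    using computable_enum_norep_enumeration unfolding computable_enum_norep_def by blast
  have "pas_extensional enumeration"
    unfolding pas_extensional_def using inj_enumeration by blast
  moreover have "pas_total enumeration k" by (simp add: pas_total_def k)
  moreover have "app2 enumeration k a b = Some a" for a b
    by (simp add: app2_def k enumeration_constant)
  ultimately show ?thesis using computable_enum_norep_enumeration by blast
qed

end
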